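(* Let $n\geq 15$ with $n\equiv 3\pmod 4$ and $r=5$. Let $V=\{x_1,\dots,x_{n-10}\}\sqcup\{u_1,\dots,u_5\}\sqcup\{w_1,\dots,w_5\}$ and consider the labelled graph on $V$ with edges: a terminal-1 alternating path on $x_1,\dots,x_{n-10}$; $\{x_{n-10},u_1\}$ with label $2$; $\{u_1,u_2\}$ and $\{u_3,u_4\}$ with label $3$; $\{u_2,u_3\}$ and $\{u_4,u_5\}$ with label $4$; $\{w_1,w_2\}$ and $\{w_3,w_4\}$ with label $3$; $\{w_2,w_3\}$ with the two labels $2$ and $4$; $\{w_4,w_5\}$ with label $4$; and $\{u_4,w_4\}$, $\{u_5,w_5\}$ with label $2$. Then $G\cong A_n$ and $(G,(\rho_0,\dots,\rho_4))$ is a string C-group of rank 5 with Schläfli type $\{n-10,6,6,5\}$.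
   Context: A string group generated by involutions (sggi) of rank $r$ is a pair $(G,(\rho_0,\dots,\rho_{r-1}))$ where $\rho_0,\dots,\rho_{r-1}$ are involutions generating the group $G$ such that $(\rho_i\rho_j)^2=1$ whenever $|i-j|\geq 2$. It is a string C-group if in addition it satisfies the intersection property: for all $J,K\subseteq\{0,\dots,r-1\}$, $\langle \rho_j : j\in J\rangle\cap\langle\rho_k : k\in K\rangle=\langle \rho_j : j\in J\cap K\rangle$. The Schläfli type is $\{p_1,\dots,p_{r-1}\}$ where $p_i$ is the order of $\rho_{i-1}\rho_i$. Labelled-graph convention: the vertex set $V$ is finite, and each edge $\{a,b\}$ ($a\neq b$) carries one or more labels from $\{0,\dots,r-1\}$, the edges carrying any given label being pairwise disjoint; $\rho_k$ denotes the permutation of $V$ equal to the product of the transpositions $(a\,b)$ over all edges $\{a,b\}$ carrying label $k$, and $G=\langle\rho_0,\dots,\rho_{r-1}\rangle\leq \mathrm{Sym}(V)$. A terminal-1 alternating path on vertices $v_1,\dots,v_a$ means the edges $\{v_s,v_{s+1}\}$ ($1\leq s\leq a-1$), where $\{v_s,v_{s+1}\}$ carries label $1$ if $a-s$ is odd and label $0$ if $a-s$ is even (so the last edge carries label 1 and labels alternate; if $a=1$ there are no edges). *)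

theory Defs
  imports "HOL-Algebra.Sym_Groups" "HOL-Algebra.Multiplicative_Group"
begin

text \<open>A labelled edge set is a set of triples (a, b, k): the edge {a,b} carries label k.
  rho_k swaps the two endpoints of every edge carrying label k (these edges are pairwise
  disjoint) and fixes every other vertex, i.e. it is the product of the transpositions.\<close>

definition lgraph_perm :: "('a \<times> 'a \<times> nat) set \<Rightarrow> nat \<Rightarrow> 'a \<Rightarrow> 'a" where
  "lgraph_perm E k v =
     (if \<exists>w. (v, w, k) \<in> E \<or> (w, v, k) \<in> E
      then (THE w. (v, w, k) \<in> E \<or> (w, v, k) \<in> E) else v)"

definition terminal1_path :: "(nat \<Rightarrow> 'a) \<Rightarrow> nat \<Rightarrow> ('a \<times> 'a \<times> nat) set" where
  "terminal1_path x a =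
     {(x s, x (s + 1), if odd (a - s) then 1 else 0) | s. 1 \<le> s \<and> s \<le> a - 1}"

definition sggi :: "('g, 'b) monoid_scheme \<Rightarrow> (nat \<Rightarrow> 'g) \<Rightarrow> nat \<Rightarrow> bool" where
  "sggi G \<rho> r \<longleftrightarrow>
     group G \<and>
     (\<forall>i<r. \<rho> i \<in> carrier G \<and> \<rho> i \<noteq> \<one>\<^bsub>G\<^esub> \<and> \<rho> i \<otimes>\<^bsub>G\<^esub> \<rho> i = \<one>\<^bsub>G\<^esub>) \<and>
     generate G (\<rho> ` {..<r}) = carrier G \<and>
     (\<forall>i<r. \<forall>j<r. (i + 2 \<le> j \<or> j + 2 \<le> i) \<longrightarrow>
        (\<rho> i \<otimes>\<^bsub>G\<^esub> \<rho> j) [^]\<^bsub>G\<^esub> (2::nat) = \<one>\<^bsub>G\<^esub>)"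

definition intersection_property :: "('g, 'b) monoid_scheme \<Rightarrow> (nat \<Rightarrow> 'g) \<Rightarrow> nat \<Rightarrow> bool" where
  "intersection_property G \<rho> r \<longleftrightarrow>
     (\<forall>J K. J \<subseteq> {..<r} \<longrightarrow> K \<subseteq> {..<r} \<longrightarrow>
        generate G (\<rho> ` J) \<inter> generate G (\<rho> ` K) = generate G (\<rho> ` (J \<inter> K)))"

definition string_C_group :: "('g, 'b) monoid_scheme \<Rightarrow> (nat \<Rightarrow> 'g) \<Rightarrow> nat \<Rightarrow> bool" where
  "string_C_group G \<rho> r \<longleftrightarrow> sggi G \<rho> r \<and> intersection_property G \<rho> r"

definition schlafli_type :: "('g, 'b) monoid_scheme \<Rightarrow> (nat \<Rightarrow> 'g) \<Rightarrow> nat \<Rightarrow> nat list \<Rightarrow> bool" where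
  "schlafli_type G \<rho> r ps \<longleftrightarrow>
     length ps = r - 1 \<and>
     (\<forall>i. 1 \<le> i \<and> i \<le> r - 1 \<longrightarrow> group.ord G (\<rho> (i - 1) \<otimes>\<^bsub>G\<^esub> \<rho> i) = ps ! (i - 1))"

text \<open>Vertices are numbered 1..n: x_i = i (1 \<le> i \<le> n-10), u_j = n-10+j, w_j = n-5+j (1 \<le> j \<le> 5).\<close>

definition xv :: "nat \<Rightarrow> nat \<Rightarrow> nat" where "xv n i = i"
definition uv :: "nat \<Rightarrow> nat \<Rightarrow> nat" where "uv n j = n - 10 + j"
definition wv :: "nat \<Rightarrow> nat \<Rightarrow> nat" where "wv n j = n - 5 + j"

definition graph412 :: "nat \<Rightarrow> (nat \<times> nat \<times> nat) set" where
  "graph412 n =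
     terminal1_path (xv n) (n - 10) \<union>
     { (xv n (n - 10), uv n 1, 2),
       (uv n 1, uv n 2, 3), (uv n 3, uv n 4, 3),
       (uv n 2, uv n 3, 4), (uv n 4, uv n 5, 4),
       (wv n 1, wv n 2, 3), (wv n 3, wv n 4, 3),
       (wv n 2, wv n 3, 2), (wv n 2, wv n 3, 4),
       (wv n 4, wv n 5, 4),
       (uv n 4, wv n 4, 2), (uv n 5, wv n 5, 2) }"

definition rho412 :: "nat \<Rightarrow> nat \<Rightarrow> nat \<Rightarrow> nat" where
  "rho412 n k = lgraph_perm (graph412 n) k"

definition group412 :: "nat \<Rightarrow> (nat \<Rightarrow> nat) monoid" where
  "group412 n = (sym_group n)\<lparr>carrier := generate (sym_group n) (rho412 n ` {..<5})\<rparr>"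

end

theory Submission
  imports Defs
begin

text \<open>
  The intersection property is checked along intervals of generators: if it holds for
  \<open>{a..<b}\<close> and \<open>{a<..b}\<close>, and the two corresponding subgroups meet in the one generated by
  \<open>{a<..<b}\<close>, then it holds for \<open>{a..b}\<close>. Three observations settle the remaining intersections.
  An element of \<open>\<langle>\<rho>\<^sub>1,\<dots>,\<rho>\<^sub>4\<rangle>\<close> is determined by its action on the last twelve vertices, since it
  acts on the others through its sign there. An element of \<open>\<langle>\<rho>\<^sub>0,\<dots>,\<rho>\<^sub>3\<rangle>\<close> acts on the last eight
  vertices as one of the twelve elements of the dihedral group \<open>\<langle>\<rho>\<^sub>2,\<rho>\<^sub>3\<rangle>\<close>. Finally
  \<open>\<langle>\<rho>\<^sub>2,\<rho>\<^sub>3,\<rho>\<^sub>4\<rangle>\<close> preserves a biplane on eleven points (it is a copy of \<open>PSL(2,11)\<close>), so it contains no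
  3-cycle. On the other hand the whole group contains 3-cycles, and conjugating them along the edges of
  the graph gives all of them, so that it is the alternating group.
\<close>

section \<open>The intersection property along intervals\<close>

text \<open>Involutions are their own inverses, so every element of the generated subgroup is a word
  that can be built by prepending one generator at a time.\<close>

lemma (in group) generate_left_induct [consumes 2, case_names one mult]:
  assumes "h \<in> generate G S"
    and involution: "\<And>s. s \<in> S \<Longrightarrow> s \<in> carrier G \<and> s \<otimes> s = \<one>"
    and one: "P \<one>"
    and mult: "\<And>s h. s \<in> S \<Longrightarrow> h \<in> generate G S \<Longrightarrow> P h \<Longrightarrow> P (s \<otimes> h)"
  shows "P h"
proof -
  have sub: "S \<subseteq> carrier G" using involution by auto
  \<comment> \<open>Strengthened to all right factors \<open>g\<close>, because \<open>P h\<close>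
    alone does not pass through the case of a product of two subgroup elements.\<close>
  have "\<forall>g\<in>generate G S. P g \<longrightarrow> P (h \<otimes> g)"
    using assms(1)
  proof induction
    case one
    then show ?case using generate_in_carrier[OF sub] by auto
  next
    case (incl h)
    then show ?case using mult by blast
  next
    case (inv h)
    then have "inv h = h" using involution inv_unique' by (metis inv_equality)
    then show ?case using inv mult by simp
  next
    case (eng h1 h2)
    show ?case
    proof (intro ballI impI)
      fix g assume g: "g \<in> generate G S" "P g"
      have "h1 \<otimes> (h2 \<otimes> g) = h1 \<otimes> h2 \<otimes> g"
        using generate_in_carrier[OF sub] eng.hyps g(1) by (simp add: m_assoc)
      moreover have "P (h1 \<otimes> (h2 \<otimes> g))"
        using eng g generate.eng by metis
      ultimately show "P (h1 \<otimes> h2 \<otimes> g)" by simp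
    qed
  qed
  then have "P (h \<otimes> \<one>)" using one generate.one by blast
  then show ?thesis using generate_in_carrier[OF sub assms(1)] by simp
qed

definition intersection_property_on ::
    "('g, 'b) monoid_scheme \<Rightarrow> (nat \<Rightarrow> 'g) \<Rightarrow> nat set \<Rightarrow> bool" where
  "intersection_property_on G \<rho> I \<longleftrightarrow>
     (\<forall>J K. J \<subseteq> I \<longrightarrow> K \<subseteq> I \<longrightarrow>
        generate G (\<rho> ` J) \<inter> generate G (\<rho> ` K) = generate G (\<rho> ` (J \<inter> K)))"

locale string_generators = group G for G (structure) +
  fixes \<rho> :: "nat \<Rightarrow> 'a" and r :: nat
  assumes gen_closed: "i < r \<Longrightarrow> \<rho> i \<in> carrier G"
    and gen_square: "i < r \<Longrightarrow> \<rho> i \<otimes> \<rho> i = \<one>"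
    and gen_commute: "i + 2 \<le> j \<Longrightarrow> j < r \<Longrightarrow> \<rho> i \<otimes> \<rho> j = \<rho> j \<otimes> \<rho> i"
begin

abbreviation parabolic :: "nat set \<Rightarrow> 'a set" where
  "parabolic J \<equiv> generate G (\<rho> ` J)"

lemma gens_closed: "J \<subseteq> {..<r} \<Longrightarrow> \<rho> ` J \<subseteq> carrier G"
  using gen_closed by auto

lemma parabolic_closed: "J \<subseteq> {..<r} \<Longrightarrow> g \<in> parabolic J \<Longrightarrow> g \<in> carrier G"
  using generate_in_carrier[OF gens_closed] by blast

lemma parabolic_inv: "J \<subseteq> {..<r} \<Longrightarrow> g \<in> parabolic J \<Longrightarrow> inv g \<in> parabolic J"
  using generate_m_inv_closed[OF gens_closed] by blast

lemma parabolic_mono: "J \<subseteq> K \<Longrightarrow> g \<in> parabolic J \<Longrightarrow> g \<in> parabolic K"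
  using mono_generate[of "\<rho> ` J" "\<rho> ` K"] by blast

lemma parabolic_induct [consumes 2, case_names one mult]:
  assumes "g \<in> parabolic J" "J \<subseteq> {..<r}" "P \<one>"
    "\<And>k h. k \<in> J \<Longrightarrow> h \<in> parabolic J \<Longrightarrow> P h \<Longrightarrow> P (\<rho> k \<otimes> h)"
  shows "P g"
  by (rule generate_left_induct[OF assms(1)]) (use assms gen_closed gen_square in auto)

lemma gen_commute_parabolic:
  assumes "g \<in> parabolic J" "J \<subseteq> {..<r}" "k < r" "\<And>i. i \<in> J \<Longrightarrow> i + 2 \<le> k"
  shows "\<rho> k \<otimes> g = g \<otimes> \<rho> k"
  using assms(1,2)
proof (induction rule: parabolic_induct)
  case one
  then show ?case using gen_closed assms by simp
next
  case (mult i h)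
  have c: "\<rho> i \<in> carrier G" "\<rho> k \<in> carrier G" "h \<in> carrier G"
    using gen_closed mult assms parabolic_closed by auto
  have "\<rho> k \<otimes> \<rho> i = \<rho> i \<otimes> \<rho> k"
    using gen_commute[of i k] assms mult by simp
  then show ?case using c mult.IH by (metis m_assoc)
qed

text \<open>Generators on opposite sides of the missing index \<open>j\<close> commute, so the
  letters below \<open>j\<close> can be moved to the front of the word.\<close>

lemma parabolic_split:
  assumes "g \<in> parabolic J" "J \<subseteq> {..<r}" "j \<notin> J"
  shows "\<exists>\<alpha>\<in>parabolic (J \<inter> {..<j}). \<exists>\<beta>\<in>parabolic (J \<inter> {j<..}). g = \<alpha> \<otimes> \<beta>"
  using assms(1,2)
proof (induction rule: parabolic_induct)
  case one
  then show ?case using generate.one by (metis l_one one_closed)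
next
  case (mult k h)
  then obtain \<alpha> \<beta> where ab: "\<alpha> \<in> parabolic (J \<inter> {..<j})" "\<beta> \<in> parabolic (J \<inter> {j<..})"
    "h = \<alpha> \<otimes> \<beta>" by blast
  have c: "\<rho> k \<in> carrier G" "\<alpha> \<in> carrier G" "\<beta> \<in> carrier G"
    using gen_closed mult(1) assms(2) parabolic_closed[OF _ ab(1)] parabolic_closed[OF _ ab(2)]
    by auto
  have "k \<noteq> j" using mult assms by auto
  then consider "k < j" | "j < k" by linarith
  then show ?case
  proof cases
    case 1
    then have "\<rho> k \<otimes> \<alpha> \<in> parabolic (J \<inter> {..<j})"
      by (intro generate.eng[OF generate.incl ab(1)]) (use 1 mult in auto)
    then show ?thesis using ab c by (metis m_assoc)
  next
    case 2
    then have "\<rho> k \<otimes> \<beta> \<in> parabolic (J \<inter> {j<..})"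
      by (intro generate.eng[OF generate.incl ab(2)]) (use 2 mult in auto)
    moreover have "\<rho> k \<otimes> \<alpha> = \<alpha> \<otimes> \<rho> k"
      by (rule gen_commute_parabolic[OF ab(1)]) (use 2 assms mult in auto)
    ultimately show ?thesis using ab c by (metis m_assoc)
  qed
qed

lemma intersection_onD:
  assumes "intersection_property_on G \<rho> I" "J \<subseteq> I" "K \<subseteq> I"
    "g \<in> parabolic J" "g \<in> parabolic K"
  shows "g \<in> parabolic (J \<inter> K)"
  using assms unfolding intersection_property_on_def by blast

text \<open>Comparing the factorisations of \<open>g\<close> at the missing indices \<open>j\<close>
  and \<open>k\<close> yields \<open>g = \<alpha> \<otimes> (inv h \<otimes> \<delta>)\<close>,
  whose three factors use letters of \<open>J \<inter> K\<close> below \<open>j\<close>, strictly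
  between \<open>j\<close> and \<open>k\<close>, and above \<open>k\<close>.\<close>

lemma intersection_interval_aux:
  assumes ab: "a \<le> b" "b < r"
    and L: "intersection_property_on G \<rho> {a..<b}"
    and R: "intersection_property_on G \<rho> {a<..b}"
    and M: "parabolic {a..<b} \<inter> parabolic {a<..b} \<subseteq> parabolic {a<..<b}"
    and JK: "J \<subseteq> {a..b}" "K \<subseteq> {a..b}" "j \<in> {a..b} - J" "k \<in> {a..b} - K" "j \<le> k"
    and g: "g \<in> parabolic J" "g \<in> parabolic K"
  shows "g \<in> parabolic (J \<inter> K)"
proof -
  have sub: "X \<subseteq> {a..b} \<Longrightarrow> X \<subseteq> {..<r}" for X using ab by auto
  obtain \<alpha> \<beta> where 1: "\<alpha> \<in> parabolic (J \<inter> {..<j})" "\<beta> \<in> parabolic (J \<inter> {j<..})" "g = \<alpha> \<otimes> \<beta>"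
    using parabolic_split[OF g(1) sub[OF JK(1)]] JK by blast
  obtain \<gamma> \<delta> where 2: "\<gamma> \<in> parabolic (K \<inter> {..<k})" "\<delta> \<in> parabolic (K \<inter> {k<..})" "g = \<gamma> \<otimes> \<delta>"
    using parabolic_split[OF g(2) sub[OF JK(2)]] JK by blast
  have c [simp]: "\<alpha> \<in> carrier G" "\<beta> \<in> carrier G" "\<gamma> \<in> carrier G" "\<delta> \<in> carrier G"
    using parabolic_closed[OF _ 1(1)] parabolic_closed[OF _ 1(2)]
      parabolic_closed[OF _ 2(1)] parabolic_closed[OF _ 2(2)] sub[OF JK(1)] sub[OF JK(2)] by auto
  \<comment> \<open>By \<open>\<alpha> \<otimes> \<beta> = \<gamma> \<otimes> \<delta>\<close>, this
    discrepancy can be written both with letters below \<open>k\<close> and with letters above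
    \<open>j\<close>.\<close>
  define h where "h = inv \<gamma> \<otimes> \<alpha>"
  have hc [simp]: "h \<in> carrier G" unfolding h_def by simp
  have eq: "\<alpha> \<otimes> \<beta> = \<gamma> \<otimes> \<delta>" using 1 2 by simp
  have h2: "h = \<delta> \<otimes> inv \<beta>"
  proof -
    have "h \<otimes> \<beta> = inv \<gamma> \<otimes> (\<alpha> \<otimes> \<beta>)" unfolding h_def by (simp add: m_assoc)
    also have "\<dots> = \<delta>" unfolding eq by (simp add: m_assoc[symmetric])
    finally show ?thesis using inv_solve_right[of h \<delta> \<beta>] by simp
  qed
  have hL: "h \<in> parabolic {a..<k}"
    unfolding h_def using JK ab
    by (intro generate.eng parabolic_inv parabolic_mono[OF _ 2(1)] parabolic_mono[OF _ 1(1)]) auto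
  have hR: "h \<in> parabolic {j<..b}"
    unfolding h2 using JK ab
    by (intro generate.eng parabolic_inv parabolic_mono[OF _ 2(2)] parabolic_mono[OF _ 1(2)]) auto
  have hM: "h \<in> parabolic {a<..<b}"
  proof -
    have "{a..<k} \<subseteq> {a..<b}" "{j<..b} \<subseteq> {a<..b}" using JK by auto
    then show ?thesis using M parabolic_mono[OF _ hL] parabolic_mono[OF _ hR] by blast
  qed
  \<comment> \<open>Once \<open>M\<close> has placed \<open>h\<close> in the middle parabolic,
    \<open>L\<close> and \<open>R\<close> apply to it, and together they leave only letters strictly
    between \<open>j\<close> and \<open>k\<close>.\<close>
  have h3: "h \<in> parabolic ({a..<k} \<inter> {a<..<b})"
    by (rule intersection_onD[OF L _ _ hL hM]) (use JK in auto)
  have h4: "h \<in> parabolic ({j<..b} \<inter> {a<..<b})"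
    by (rule intersection_onD[OF R _ _ hR hM]) (use JK in auto)
  have "h \<in> parabolic (({a..<k} \<inter> {a<..<b}) \<inter> ({j<..b} \<inter> {a<..<b}))"
    by (rule intersection_onD[OF L _ _ h3 h4]) (use JK in auto)
  then have h: "h \<in> parabolic {j<..<k}"
    by (rule parabolic_mono[rotated]) auto
  have \<alpha>: "\<alpha> = \<gamma> \<otimes> h" unfolding h_def by (simp add: m_assoc[symmetric])
  have \<delta>: "\<delta> = h \<otimes> \<beta>" unfolding h2 by (simp add: m_assoc)
  \<comment> \<open>The letters between \<open>j\<close> and \<open>k\<close> contributed by
    \<open>h\<close> disappear again, since \<open>\<alpha>\<close> also has a word with letters
    below \<open>j\<close> only.\<close>
  have "\<alpha> \<in> parabolic (K \<inter> {..<k} \<union> {j<..<k})"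
    unfolding \<alpha> by (intro generate.eng parabolic_mono[OF _ 2(1)] parabolic_mono[OF _ h]) auto
  then have "\<alpha> \<in> parabolic ((J \<inter> {..<j}) \<inter> (K \<inter> {..<k} \<union> {j<..<k}))"
    by (intro intersection_onD[OF L _ _ 1(1)]) (use JK in auto)
  then have \<alpha>': "\<alpha> \<in> parabolic (J \<inter> K \<inter> {..<j})"
    by (rule parabolic_mono[rotated]) auto
  have "\<delta> \<in> parabolic (J \<inter> {j<..} \<union> {j<..<k})"
    unfolding \<delta> by (intro generate.eng parabolic_mono[OF _ 1(2)] parabolic_mono[OF _ h]) auto
  then have "\<delta> \<in> parabolic ((K \<inter> {k<..}) \<inter> (J \<inter> {j<..} \<union> {j<..<k}))"
    by (intro intersection_onD[OF R _ _ 2(2)]) (use JK in auto)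
  then have \<delta>': "\<delta> \<in> parabolic (J \<inter> K \<inter> {k<..})"
    by (rule parabolic_mono[rotated]) auto
  \<comment> \<open>With \<open>\<alpha>\<close> and \<open>\<delta>\<close> now expressed in
    letters of \<open>J \<inter> K\<close>, the two formulas for \<open>h\<close> place it in the
    parabolics of \<open>K\<close> and of \<open>J\<close>.\<close>
  have "h \<in> parabolic (K \<inter> {..<k})"
    unfolding h_def using JK ab
    by (intro generate.eng parabolic_inv 2(1) parabolic_mono[OF _ \<alpha>']) auto
  then have h5: "h \<in> parabolic ({j<..<k} \<inter> (K \<inter> {..<k}))"
    by (intro intersection_onD[OF L _ _ h]) (use JK in auto)
  have "h \<in> parabolic (J \<inter> {j<..})"
    unfolding h2 using JK ab
    by (intro generate.eng parabolic_inv 1(2) parabolic_mono[OF _ \<delta>']) auto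
  then have h6: "h \<in> parabolic ({j<..<k} \<inter> (J \<inter> {j<..}))"
    by (intro intersection_onD[OF R _ _ h]) (use JK in auto)
  have "h \<in> parabolic (({j<..<k} \<inter> (K \<inter> {..<k})) \<inter> ({j<..<k} \<inter> (J \<inter> {j<..})))"
    by (rule intersection_onD[OF L _ _ h5 h6]) (use JK in auto)
  then have "h \<in> parabolic (J \<inter> K)"
    by (rule parabolic_mono[rotated]) auto
  moreover have "\<alpha> \<in> parabolic (J \<inter> K)" "\<delta> \<in> parabolic (J \<inter> K)"
    using parabolic_mono[OF _ \<alpha>', of "J \<inter> K"] parabolic_mono[OF _ \<delta>', of "J \<inter> K"] by auto
  moreover have "g = \<alpha> \<otimes> (inv h \<otimes> \<delta>)"
    unfolding 1(3) \<delta> by (simp add: m_assoc[symmetric])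
  ultimately show ?thesis
    using parabolic_inv[OF sub[of "J \<inter> K"]] JK by (auto intro: generate.eng)
qed

text \<open>If \<open>J\<close> or \<open>K\<close> is the whole interval there is nothing to prove;
  otherwise each misses an index, and exchanging \<open>J\<close> and \<open>K\<close> arranges
  \<open>j \<le> k\<close>.\<close>

lemma intersection_interval:
  assumes ab: "a \<le> b" "b < r"
    and L: "intersection_property_on G \<rho> {a..<b}"
    and R: "intersection_property_on G \<rho> {a<..b}"
    and M: "parabolic {a..<b} \<inter> parabolic {a<..b} \<subseteq> parabolic {a<..<b}"
  shows "intersection_property_on G \<rho> {a..b}"
  unfolding intersection_property_on_def
proof (intro allI impI)
  fix J K assume JK: "J \<subseteq> {a..b}" "K \<subseteq> {a..b}"
  have "g \<in> parabolic (J \<inter> K)" if g: "g \<in> parabolic J" "g \<in> parabolic K" for g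
  proof (cases "J = {a..b} \<or> K = {a..b}")
    case True
    then have "J \<inter> K = J \<or> J \<inter> K = K" using JK by auto
    then show ?thesis using g by auto
  next
    case False
    then obtain j k where jk: "j \<in> {a..b} - J" "k \<in> {a..b} - K" using JK by blast
    show ?thesis
    proof (cases "j \<le> k")
      case True
      show ?thesis by (rule intersection_interval_aux[OF ab L R M JK jk True g])
    next
      case False
      then have "k \<le> j" by simp
      from intersection_interval_aux[OF ab L R M JK(2,1) jk(2,1) this g(2,1)]
      show ?thesis by (simp add: Int_commute)
    qed
  qed
  moreover have "parabolic (J \<inter> K) \<subseteq> parabolic J \<inter> parabolic K"
    using parabolic_mono[of "J \<inter> K"] by blast
  ultimately show "parabolic J \<inter> parabolic K = parabolic (J \<inter> K)" by blast
qed

end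

section \<open>The generators as explicit permutations\<close>

text \<open>Models the edges of a single label along the path; with the factors added one at a time,
  support and parity follow by induction.\<close>

primrec ladder :: "nat \<Rightarrow> nat \<Rightarrow> nat \<Rightarrow> nat" where
  "ladder a 0 = id"
| "ladder a (Suc k) = transpose (a + 2 * k) (a + 2 * k + 1) \<circ> ladder a k"

lemma ladder_apply:
  "ladder a k i = (if a \<le> i \<and> i < a + 2 * k then if even (i - a) then i + 1 else i - 1 else i)"
proof (induction k)
  case (Suc k)
  consider "i = a + 2 * k" | "i = a + 2 * k + 1" | "i < a + 2 * k" | "i > a + 2 * k + 1" by linarith
  then show ?case
  proof cases
    case 3
    have "ladder a k i < a + 2 * k"
    proof (cases "a \<le> i \<and> even (i - a)")
      case True
      then have "i - a < 2 * k" "even (i - a)" using 3 by auto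
      then have "i - a + 1 < 2 * k" by presburger
      then have "i + 1 < a + 2 * k" using True by linarith
      then show ?thesis using True 3 Suc by (simp del: even_diff_nat)
    qed (use 3 Suc in auto)
    then have "ladder a (Suc k) i = ladder a k i" by (simp add: transpose_def)
    then show ?thesis using 3 Suc by simp
  qed (use Suc in simp_all)
qed simp

lemma ladder_permutes: "ladder a k permutes {a..<a + 2 * k}"
proof (induction k)
  case (Suc k)
  have "ladder a k permutes {a..<a + 2 * Suc k}"
    by (rule permutes_subset[OF Suc]) auto
  then show ?case
    unfolding ladder.simps by (intro permutes_compose permutes_swap_id) simp_all
qed (simp only: ladder.simps permutes_id)

lemma evenperm_ladder: "evenperm (ladder a k) \<longleftrightarrow> even k"
proof (induction k)
  case (Suc k)
  have "permutation (ladder a k)"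
    using ladder_permutes permutation_permutes by blast
  then show ?case
    unfolding ladder.simps evenperm_comp[OF permutation_swap_id \<open>permutation (ladder a k)\<close>]
    by (simp add: evenperm_swap Suc)
qed simp

text \<open>
  Here \<open>n = q + 13\<close>: the vertices \<open>q+2\<close> and \<open>q+3\<close> are the last two of the path, \<open>q+4,\<dots>,q+8\<close> are
  \<open>u\<^sub>1,\<dots>,u\<^sub>5\<close>, and \<open>q+9,\<dots>,q+13\<close> are \<open>w\<^sub>1,\<dots>,w\<^sub>5\<close>. An index \<open>k \<ge> 5\<close> gives a junk value.
\<close>

definition gen :: "nat \<Rightarrow> nat \<Rightarrow> nat \<Rightarrow> nat" where
  "gen q k =
    [ladder 1 (q div 2 + 1),
     transpose (q+2) (q+3) \<circ> ladder 2 (q div 2),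
     transpose (q+3) (q+4) \<circ> transpose (q+7) (q+12) \<circ> transpose (q+8) (q+13) \<circ> transpose (q+10) (q+11),
     transpose (q+4) (q+5) \<circ> transpose (q+6) (q+7) \<circ> transpose (q+9) (q+10) \<circ> transpose (q+11) (q+12),
     transpose (q+5) (q+6) \<circ> transpose (q+7) (q+8) \<circ> transpose (q+10) (q+11) \<circ> transpose (q+12) (q+13)] ! k"

lemma lgraph_perm_eqI:
  assumes "\<And>a b. (a, b, k) \<in> E \<or> (b, a, k) \<in> E \<longleftrightarrow> f a = b \<and> a \<noteq> b"
  shows "lgraph_perm E k = f"
proof
  fix v
  show "lgraph_perm E k v = f v"
    unfolding lgraph_perm_def assms by auto
qed

lemma below_5: "k < 5 \<Longrightarrow> k = 0 \<or> k = 1 \<or> k = 2 \<or> k = 3 \<or> k = (4::nat)"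
  by presburger

lemma gen_simps:
  "gen q 0 = ladder 1 (q div 2 + 1)"
  "gen q 1 = transpose (q+2) (q+3) \<circ> ladder 2 (q div 2)"
  by (simp_all add: gen_def)

lemma gen_tail_simps:
  "gen q 2 = transpose (q+3) (q+4) \<circ> transpose (q+7) (q+12) \<circ> transpose (q+8) (q+13) \<circ> transpose (q+10) (q+11)"
  "gen q 3 = transpose (q+4) (q+5) \<circ> transpose (q+6) (q+7) \<circ> transpose (q+9) (q+10) \<circ> transpose (q+11) (q+12)"
  "gen q 4 = transpose (q+5) (q+6) \<circ> transpose (q+7) (q+8) \<circ> transpose (q+10) (q+11) \<circ> transpose (q+12) (q+13)"
  by (simp_all add: gen_def)

text \<open>The argument \<open>q + 2\<close> appears as \<open>Suc (Suc q)\<close>, the form to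
  which the simplifier normalises it.\<close>

lemma gen_table [simp]:
  "gen q 2 (Suc (Suc q)) = Suc (Suc q)" "gen q 3 (Suc (Suc q)) = Suc (Suc q)" "gen q 4 (Suc (Suc q)) = Suc (Suc q)"
  "gen q 2 (q+3) = q+4" "gen q 2 (q+4) = q+3" "gen q 2 (q+5) = q+5" "gen q 2 (q+6) = q+6" "gen q 2 (q+7) = q+12" "gen q 2 (q+8) = q+13" "gen q 2 (q+9) = q+9" "gen q 2 (q+10) = q+11" "gen q 2 (q+11) = q+10" "gen q 2 (q+12) = q+7" "gen q 2 (q+13) = q+8"
  "gen q 3 (q+3) = q+3" "gen q 3 (q+4) = q+5" "gen q 3 (q+5) = q+4" "gen q 3 (q+6) = q+7" "gen q 3 (q+7) = q+6" "gen q 3 (q+8) = q+8" "gen q 3 (q+9) = q+10" "gen q 3 (q+10) = q+9" "gen q 3 (q+11) = q+12" "gen q 3 (q+12) = q+11" "gen q 3 (q+13) = q+13"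
  "gen q 4 (q+3) = q+3" "gen q 4 (q+4) = q+4" "gen q 4 (q+5) = q+6" "gen q 4 (q+6) = q+5" "gen q 4 (q+7) = q+8" "gen q 4 (q+8) = q+7" "gen q 4 (q+9) = q+9" "gen q 4 (q+10) = q+11" "gen q 4 (q+11) = q+10" "gen q 4 (q+12) = q+13" "gen q 4 (q+13) = q+12"
  by (simp_all add: gen_tail_simps)

text \<open>As \<open>q + 3\<close> is odd, \<open>q + 3 - s\<close> is odd exactly for even
  \<open>s\<close>, so counting labels from the end of the path becomes a parity condition on the
  vertex.\<close>

lemma terminal1_path_iff:
  assumes "even q"
  shows "(a, b, k) \<in> terminal1_path (xv n) (q + 3) \<longleftrightarrow>
    1 \<le> a \<and> a \<le> q + 2 \<and> b = a + 1 \<and> k = (if even a then 1 else 0)"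
  using assms by (auto simp: terminal1_path_def xv_def)

text \<open>This is \<open>n mod 4 = 3\<close> for \<open>n = q + 13\<close>. It makes
  \<open>q div 2\<close> odd, so \<open>gen q 0\<close> and \<open>gen q 1\<close>, each a product
  of \<open>q div 2 + 1\<close> transpositions, are even.\<close>

locale pentagon_graph =
  fixes q :: nat
  assumes q_mod_4: "q mod 4 = 2"
begin

lemma even_q: "even q" using q_mod_4 by presburger
lemma q_ge_2: "q \<ge> 2" using q_mod_4 by presburger
lemma half_q: "2 * (q div 2) = q" "odd (q div 2)" using q_mod_4 by presburger+

lemma tail_points:
  "{q+2..q+13} = {q+2,q+3,q+4,q+5,q+6,q+7,q+8,q+9,q+10,q+11,q+12,q+13}" (is "?L = ?R")
proof (intro equalityI subsetI)
  fix i assume "i \<in> ?L"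
  then have "i - q \<in> {2..13}" "i = q + (i - q)" by auto
  then obtain j where "i = q + j" "j \<in> {2..13}" by blast
  then have "j \<in> {2,3,4,5,6,7,8,9,10,11,12,13}"
    unfolding atLeastAtMost_iff insert_iff empty_iff by presburger
  then show "i \<in> ?R" using \<open>i = q + j\<close> by auto
qed auto

lemma points_cases:
  "i \<notin> {q+2..q+13} \<or> i = q+2 \<or> i = q+3 \<or> i = q+4 \<or> i = q+5 \<or> i = q+6 \<or> i = q+7 \<or>
   i = q+8 \<or> i = q+9 \<or> i = q+10 \<or> i = q+11 \<or> i = q+12 \<or> i = q+13"
  using tail_points by blast

lemma gen_out [simp]:
  "i \<notin> {q+2..q+13} \<Longrightarrow> gen q 2 i = i"
  "i \<notin> {q+2..q+13} \<Longrightarrow> gen q 3 i = i"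
  "i \<notin> {q+2..q+13} \<Longrightarrow> gen q 4 i = i"
  by (auto simp: gen_tail_simps transpose_def)

lemma gen_0_apply:
  "gen q 0 i = (if 1 \<le> i \<and> i \<le> q + 2 then if odd i then i + 1 else i - 1 else i)"
proof -
  have "1 + 2 * (q div 2 + 1) = q + 3" using half_q by simp
  then show ?thesis by (simp add: gen_simps ladder_apply del: ladder.simps)
qed

lemma gen_1_apply:
  "gen q 1 i = (if 2 \<le> i \<and> i \<le> q + 3 then if even i then i + 1 else i - 1 else i)"
proof -
  have l: "ladder 2 (q div 2) i = (if 2 \<le> i \<and> i < q + 2 then if even i then i + 1 else i - 1 else i)"
    using half_q by (simp add: ladder_apply)
  have g: "gen q 1 i = transpose (q+2) (q+3) (ladder 2 (q div 2) i)"
    by (simp add: gen_simps(2)[unfolded One_nat_def])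
  consider "i = q + 2" | "i = q + 3" | "2 \<le> i" "i < q + 2" | "i < 2 \<or> i > q + 3" by linarith
  then show ?thesis
  proof cases
    case 1
    have "gen q 1 i = q + 3" using g l 1 by simp
    then show ?thesis using 1 even_q by simp
  next
    case 2
    have "gen q 1 i = q + 2" using g l 2 by simp
    then show ?thesis using 2 even_q by simp
  next
    case 3
    then have "ladder 2 (q div 2) i < q + 2" unfolding l using even_q by presburger
    then have "gen q 1 i = ladder 2 (q div 2) i" unfolding g by (simp add: transpose_def)
    then show ?thesis using 3 unfolding l by simp
  next
    case 4
    have "gen q 1 i = i" using g l 4 by (auto simp: transpose_def)
    then show ?thesis using 4 by auto
  qed
qed

abbreviation n where "n \<equiv> q + 13"

lemma rho412_eq_gen:
  assumes "k < 5"
  shows "rho412 (q + 13) k = gen q k"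
  unfolding rho412_def
proof (rule lgraph_perm_eqI)
  fix a b
  have n: "q + 13 - 10 = q + 3" "q + 13 - 5 = q + 8" by simp_all
  have h: "2 * (q div 2) = q" "1 + 2 * (q div 2 + 1) = q + 3" "2 + 2 * (q div 2) = q + 2" using half_q by simp_all
  show "((a, b, k) \<in> graph412 (q + 13) \<or> (b, a, k) \<in> graph412 (q + 13)) = (gen q k a = b \<and> a \<noteq> b)"
    using below_5[OF assms]
  proof (elim disjE)
    assume "k = 0"
    have "(a, b, 0) \<in> graph412 n \<longleftrightarrow> 1 \<le> a \<and> a \<le> q + 2 \<and> b = a + 1 \<and> odd a" for a b
      by (auto simp: graph412_def n terminal1_path_iff[OF even_q])
    note * = this
    show ?thesis
      using even_q unfolding \<open>k = 0\<close> gen_0_apply * by presburger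
  next
    assume "k = 1"
    have "(a, b, 1) \<in> graph412 n \<longleftrightarrow> 2 \<le> a \<and> a \<le> q + 2 \<and> b = a + 1 \<and> even a" for a b
      unfolding graph412_def n Un_iff terminal1_path_iff[OF even_q] by (simp, presburger)
    note * = this
    show ?thesis
      using even_q unfolding \<open>k = 1\<close> gen_1_apply * by presburger
  next
    assume "k = 2"
    have "(a, b, 2) \<in> graph412 n \<longleftrightarrow> (a, b) \<in> {(q+3, q+4), (q+10, q+11), (q+7, q+12), (q+8, q+13)}" for a b
      unfolding graph412_def n Un_iff terminal1_path_iff[OF even_q] by (simp add: xv_def uv_def wv_def add.commute)
    note * = this
    show ?thesis
      unfolding \<open>k = 2\<close> * using points_cases[of a] by (elim disjE; simp; auto)
  next
    assume "k = 3"
    have "(a, b, 3) \<in> graph412 n \<longleftrightarrow> (a, b) \<in> {(q+4, q+5), (q+6, q+7), (q+9, q+10), (q+11, q+12)}" for a b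
      unfolding graph412_def n Un_iff terminal1_path_iff[OF even_q] by (simp add: xv_def uv_def wv_def add.commute)
    note * = this
    show ?thesis
      unfolding \<open>k = 3\<close> * using points_cases[of a] by (elim disjE; simp; auto)
  next
    assume "k = 4"
    have "(a, b, 4) \<in> graph412 n \<longleftrightarrow> (a, b) \<in> {(q+5, q+6), (q+7, q+8), (q+10, q+11), (q+12, q+13)}" for a b
      unfolding graph412_def n Un_iff terminal1_path_iff[OF even_q] by (simp add: xv_def uv_def wv_def add.commute)
    note * = this
    show ?thesis
      unfolding \<open>k = 4\<close> * using points_cases[of a] by (elim disjE; simp; auto)
  qed
qed

lemma gen_permutes: "k < 5 \<Longrightarrow> gen q k permutes {1..n}"
proof -
  assume "k < 5"
  have "ladder 1 (q div 2 + 1) permutes {1..n}"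
    by (rule permutes_subset[OF ladder_permutes]) auto
  moreover have "ladder 2 (q div 2) permutes {1..n}"
    by (rule permutes_subset[OF ladder_permutes]) auto
  ultimately show ?thesis using below_5[OF \<open>k < 5\<close>]
    by (elim disjE; simp only: gen_simps gen_tail_simps; intro permutes_compose permutes_swap_id) simp_all
qed

lemma evenperm_gen: "k < 5 \<Longrightarrow> evenperm (gen q k)"
proof -
  assume "k < 5"
  have p: "permutation (ladder a k)" for a k
    using ladder_permutes permutation_permutes by blast
  show ?thesis using below_5[OF \<open>k < 5\<close>] half_q
    by (elim disjE; simp only: gen_simps gen_tail_simps evenperm_comp permutation_compose
        permutation_swap_id p evenperm_swap evenperm_ladder) simp_all
qed

lemma gen_path [simp]:
  "k \<in> {2,3,4} \<Longrightarrow> i \<le> q + 2 \<Longrightarrow> gen q k i = i"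
  by (auto simp: gen_tail_simps transpose_def)

lemma gen_path' [simp]:
  "k \<in> {3,4} \<Longrightarrow> i \<le> q + 3 \<Longrightarrow> gen q k i = i"
  by (auto simp: gen_tail_simps transpose_def)

lemma gen_involution: "k < 5 \<Longrightarrow> gen q k \<circ> gen q k = id"
proof -
  assume k: "k < 5"
  have "gen q k (gen q k i) = i" for i
    using below_5[OF k]
  proof (elim disjE)
    assume "k = 0"
    show ?thesis using even_q unfolding \<open>k = 0\<close> gen_0_apply by presburger
  next
    assume "k = 1"
    show ?thesis using even_q unfolding \<open>k = 1\<close> gen_1_apply by presburger
  qed (use points_cases[of i] in \<open>elim disjE; simp\<close>)+
  then show ?thesis by (simp add: fun_eq_iff)
qed

text \<open>Supports are disjoint except for \<open>\<rho>\<^sub>2\<close> and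
  \<open>\<rho>\<^sub>4\<close>, which overlap on the tail and are compared point by point.\<close>

lemma gen_commute:
  assumes "i + 2 \<le> j" "j < 5"
  shows "gen q i \<circ> gen q j = gen q j \<circ> gen q i"
proof
  fix x
  consider "i = 0" "j = 2 \<or> j = 3 \<or> j = 4" | "i = 1" "j = 3 \<or> j = 4" | "i = 2" "j = 4"
    using assms by linarith
  then show "(gen q i \<circ> gen q j) x = (gen q j \<circ> gen q i) x"
  proof cases
    case 1
    show ?thesis
    proof (cases "x \<le> q + 2")
      case True
      then have "gen q 0 x \<le> q + 2" unfolding gen_0_apply using even_q by presburger
      then show ?thesis using True 1 by (auto simp del: One_nat_def)
    next
      case False
      then have "gen q j x > q + 2" using 1 points_cases[of x] by (elim disjE; simp)
      then show ?thesis using False 1 by (simp add: gen_0_apply del: One_nat_def)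
    qed
  next
    case 2
    show ?thesis
    proof (cases "x \<le> q + 3")
      case True
      then have "gen q 1 x \<le> q + 3" unfolding gen_1_apply using even_q by presburger
      then show ?thesis using True 2 by (auto simp del: One_nat_def)
    next
      case False
      then have "gen q j x > q + 3" using 2 points_cases[of x] by (elim disjE; simp)
      then show ?thesis using False 2 by (simp add: gen_1_apply del: One_nat_def)
    qed
  next
    case 3
    then show ?thesis using points_cases[of x] by (elim disjE; simp)
  qed
qed

end

section \<open>Intersections of parabolic subgroups\<close>

lemma transpose_conj_involution:
  assumes "f \<circ> f = id"
  shows "f \<circ> transpose a b \<circ> f = transpose (f a) (f b)"
proof
  fix x
  have f: "f (f y) = y" for y using assms by (simp add: fun_eq_iff)
  have inj: "f x = y \<longleftrightarrow> x = f y" for x y using f by metis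
  show "(f \<circ> transpose a b \<circ> f) x = transpose (f a) (f b) x"
    by (simp add: transpose_def f inj)
qed

context pentagon_graph
begin

abbreviation R :: "nat set \<Rightarrow> (nat \<Rightarrow> nat) set" where
  "R J \<equiv> generate (sym_group n) (gen q ` J)"

text \<open>The rewrites turn the inherited lemmas into statements about composition and
  \<open>id\<close>.\<close>

sublocale string_generators "sym_group n" "gen q" 5
  rewrites "mult (sym_group n) = (\<circ>)" and "one (sym_group n) = id"
proof -
  interpret group "sym_group n" by (rule sym_group_is_group)
  show "string_generators (sym_group n) (gen q) 5"
  proof
    show "gen q i \<in> carrier (sym_group n)" if "i < 5" for i
      using gen_permutes[OF that] by (simp add: sym_group_carrier)
    show "gen q i \<otimes>\<^bsub>sym_group n\<^esub> gen q i = \<one>\<^bsub>sym_group n\<^esub>" if "i < 5" for i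
      using gen_involution[OF that] by (simp add: sym_group_def)
    show "gen q i \<otimes>\<^bsub>sym_group n\<^esub> gen q j = gen q j \<otimes>\<^bsub>sym_group n\<^esub> gen q i"
      if "i + 2 \<le> j" "j < 5" for i j
      using gen_commute[OF that] by (simp add: sym_group_def)
  qed
qed (simp_all add: sym_group_def)

lemma R_id: "id \<in> R J"
  using generate.one[of "sym_group n"] by (simp add: sym_group_one)

lemma R_gen: "k \<in> J \<Longrightarrow> gen q k \<in> R J"
  by (intro generate.incl) auto

lemma R_comp: "g \<in> R J \<Longrightarrow> h \<in> R J \<Longrightarrow> g \<circ> h \<in> R J"
  using generate.eng[of g "sym_group n"] by (simp add: sym_group_mult)

lemma R_permutes: "J \<subseteq> {..<5} \<Longrightarrow> g \<in> R J \<Longrightarrow> g permutes {1..n}"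
  using parabolic_closed sym_group_carrier by blast

lemma R_inv:
  assumes "J \<subseteq> {..<5}" "g \<in> R J"
  shows "inv' g \<in> R J"
  using parabolic_inv[OF assms] sym_group_inv_equality[OF parabolic_closed[OF assms]] by simp

lemma R_inv_comp:
  assumes "J \<subseteq> {..<5}" "g \<in> R J"
  shows "inv' g \<circ> g = id" "g \<circ> inv' g = id"
  using permutes_inv_o[OF R_permutes[OF assms]] by simp_all

lemmas R_mono = parabolic_mono
lemmas R_induct = parabolic_induct[consumes 1, case_names subset one mult]

section \<open>Permutations of the tail twisted by their sign\<close>

definition tau :: "nat \<Rightarrow> nat" where "tau = ladder 2 (q div 2)"

text \<open>
  The generators \<open>\<rho>\<^sub>2, \<rho>\<^sub>3, \<rho>\<^sub>4\<close> are even on the tail \<open>Y\<close>, while \<open>\<rho>\<^sub>1\<close> is a transposition there and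
  acts as \<open>tau\<close> on the path; hence every element they generate has the form \<open>twist s\<close>.
\<close>

definition twist :: "(nat \<Rightarrow> nat) \<Rightarrow> nat \<Rightarrow> nat" where
  "twist s = (if evenperm s then s else s \<circ> tau)"

abbreviation Y :: "nat set" where "Y \<equiv> {q+2..q+13}"

lemma tau_apply: "tau i = (if 2 \<le> i \<and> i \<le> q + 1 then if even i then i + 1 else i - 1 else i)"
  unfolding tau_def using half_q by (auto simp: ladder_apply)

lemma tau_tail: "i \<ge> q + 2 \<Longrightarrow> tau i = i"
  by (simp add: tau_apply)

lemma tau_le: "i \<le> q + 1 \<Longrightarrow> tau i \<le> q + 1"
  unfolding tau_apply using even_q by presburger

lemma tau_involution: "tau \<circ> tau = id"
proof
  show "(tau \<circ> tau) i = id i" for i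
    unfolding comp_def id_def tau_apply using even_q by presburger
qed

lemma tau_commute:
  assumes "s permutes Y"
  shows "tau \<circ> s = s \<circ> tau"
proof
  fix i
  show "(tau \<circ> s) i = (s \<circ> tau) i"
  proof (cases "i \<le> q + 1")
    case True
    then have "s i = i" "s (tau i) = tau i"
      using tau_le[OF True] by (auto intro!: permutes_not_in[OF assms])
    then show ?thesis by simp
  next
    case False
    then have "s i \<ge> q + 2"
      using permutes_in_image[OF assms, of i] permutes_not_in[OF assms, of i] by (cases "i \<in> Y") auto
    then show ?thesis using False by (simp add: tau_tail)
  qed
qed

lemma permutation_Y: "s permutes Y \<Longrightarrow> permutation s"
  using permutation_permutes by blast

text \<open>Parity is a homomorphism to a group of order two, and \<open>tau\<close> is an
  involution commuting with every permutation of \<open>Y\<close>.\<close>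

lemma twist_comp:
  assumes "s permutes Y" "t permutes Y"
  shows "twist (s \<circ> t) = twist s \<circ> twist t"
proof -
  have c: "s (tau (t x)) = s (t (tau x))" "tau (tau x) = x" for x
    using fun_cong[OF tau_commute[OF assms(2)]] fun_cong[OF tau_involution] by simp_all
  show ?thesis
    unfolding twist_def evenperm_comp[OF permutation_Y[OF assms(1)] permutation_Y[OF assms(2)]]
    by (auto simp: fun_eq_iff c)
qed

lemma gen_permutes_Y: "k \<in> {2,3,4} \<Longrightarrow> gen q k permutes Y"
  by (auto simp: gen_tail_simps intro!: permutes_compose permutes_swap_id)

lemma gen_eq_twist: "k \<in> {2,3,4} \<Longrightarrow> gen q k = twist (gen q k)"
  using evenperm_gen[of k] by (auto simp: twist_def)

lemma gen_1_eq_twist: "gen q 1 = twist (transpose (q+2) (q+3))"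
  by (simp add: twist_def evenperm_swap gen_simps(2)[unfolded One_nat_def] tau_def)

lemma R1234_twist:
  assumes "g \<in> R {1,2,3,4}"
  shows "\<exists>s. s permutes Y \<and> g = twist s"
  using assms
proof (induction rule: R_induct)
  case subset
  show ?case by simp
next
  case one
  then show ?case by (intro exI[of _ id] conjI permutes_id) (simp add: twist_def)
next
  case (mult k h)
  then obtain s where s: "s permutes Y" "h = twist s" by blast
  obtain t where t: "t permutes Y" "gen q k = twist t"
  proof (cases "k = 1")
    case True
    show ?thesis using that[of "transpose (q+2) (q+3)"] gen_1_eq_twist True
      by (simp add: permutes_swap_id)
  next
    case False
    then have "k \<in> {2,3,4}" using mult by auto
    then show ?thesis using that gen_permutes_Y gen_eq_twist by blast
  qed
  show ?case using twist_comp[OF t(1) s(1)] permutes_compose[OF s(1) t(1)] s t by metis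
qed

text \<open>Transpositions generate the symmetric group on \<open>A\<close>, and
  \<open>twist\<close> is multiplicative.\<close>

lemma twist_in_R:
  assumes "A \<subseteq> Y" "s permutes A"
    and tr: "\<And>a b. a \<in> A \<Longrightarrow> b \<in> A \<Longrightarrow> a \<noteq> b \<Longrightarrow> twist (transpose a b) \<in> R J"
  shows "twist s \<in> R J"
  using assms(2) finite_subset[OF assms(1) finite_atLeastAtMost]
proof (induction rule: permutes_induct)
  case id
  show ?case unfolding twist_def using R_id by (simp only: evenperm_id if_True)
next
  case (swap a b p)
  have eq: "twist (transpose a b \<circ> p) = twist (transpose a b) \<circ> twist p"
    using assms(1) swap.hyps(1,2)
    by (intro twist_comp permutes_swap_id permutes_subset[OF \<open>p permutes A\<close>]) (auto simp only: subset_iff)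
  show ?case unfolding eq by (rule R_comp[OF tr[OF swap.hyps(1-3)] swap.IH])
qed

text \<open>Each of these generators equals its own twist, so conjugation by it can be carried out
  inside \<open>twist\<close>.\<close>

lemma twist_transpose_gen:
  assumes "twist (transpose a b) \<in> R J" "k \<in> J" "k \<in> {2,3,4}" "a \<in> Y" "b \<in> Y"
  shows "twist (transpose (gen q k a) (gen q k b)) \<in> R J"
proof -
  have p: "gen q k permutes Y" "transpose a b permutes Y"
    by (rule gen_permutes_Y[OF assms(3)]) (rule permutes_swap_id[OF assms(4,5)])
  have "k < 5" using assms(3) by auto
  have eq: "transpose (gen q k a) (gen q k b) = gen q k \<circ> transpose a b \<circ> gen q k"
    by (rule transpose_conj_involution[OF gen_involution[OF \<open>k < 5\<close>], symmetric])
  have eq2: "twist (transpose (gen q k a) (gen q k b)) = gen q k \<circ> twist (transpose a b) \<circ> gen q k"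
    unfolding eq
      twist_comp[OF permutes_compose[OF p(2,1)] p(1)] twist_comp[OF p] gen_eq_twist[OF assms(3), symmetric]
    by (rule refl)
  show ?thesis
    unfolding eq2 by (rule R_comp[OF R_comp[OF R_gen[OF assms(2)] assms(1)] R_gen[OF assms(2)]])
qed

lemma twist_transpose_trans:
  assumes "twist (transpose a b) \<in> R J" "twist (transpose a c) \<in> R J" "a \<in> Y" "b \<in> Y" "c \<in> Y"
    "a \<noteq> b" "a \<noteq> c" "b \<noteq> c"
  shows "twist (transpose b c) \<in> R J"
proof -
  have p: "transpose a b permutes Y" "transpose a c permutes Y"
    by (rule permutes_swap_id[OF assms(3,4)]) (rule permutes_swap_id[OF assms(3,5)])
  have eq: "transpose b c = transpose a b \<circ> transpose a c \<circ> transpose a b"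
    using assms by (auto simp: fun_eq_iff transpose_def)
  have eq2: "twist (transpose b c) = twist (transpose a b) \<circ> twist (transpose a c) \<circ> twist (transpose a b)"
    unfolding eq
      twist_comp[OF permutes_compose[OF p(2,1)] p(1)] twist_comp[OF p]
    by (rule refl)
  show ?thesis
    unfolding eq2 by (rule R_comp[OF R_comp[OF assms(1,2)] assms(1)])
qed

text \<open>Transpositions sharing the point \<open>a\<close> give all others by conjugating one of
  them by another.\<close>

lemma twist_star_in_R:
  assumes "\<And>b. b \<in> A \<Longrightarrow> twist (transpose a b) \<in> R J" "insert a A \<subseteq> Y" "s permutes insert a A" "a \<notin> A"
  shows "twist s \<in> R J"
proof (rule twist_in_R[OF assms(2,3)])
  fix x y assume xy: "x \<in> insert a A" "y \<in> insert a A" "x \<noteq> y"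
  show "twist (transpose x y) \<in> R J"
  proof (cases "x = a \<or> y = a")
    case True
    then show ?thesis using xy assms(1)[of x] assms(1)[of y] transpose_commute[of x y] by auto
  next
    case False
    then have "x \<in> A" "y \<in> A" "a \<noteq> x" "a \<noteq> y" using xy by auto
    moreover have "a \<in> Y" "x \<in> Y" "y \<in> Y" using xy assms(2) by (auto simp only: insert_subset subset_iff)
    ultimately show ?thesis using twist_transpose_trans[of a x J y] assms(1) xy(3) by simp
  qed
qed

text \<open>\<open>\<rho>\<^sub>1\<close> is itself the first twist, and
  \<open>\<rho>\<^sub>2\<close> fixes \<open>q+2\<close> and carries \<open>q+3\<close> to
  \<open>q+4\<close>.\<close>

lemma twist_12:
  assumes "{1,2} \<subseteq> J"
  shows "twist (transpose (q+2) (q+3)) \<in> R J" "twist (transpose (q+2) (q+4)) \<in> R J"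
proof -
  show *: "twist (transpose (q+2) (q+3)) \<in> R J"
    using R_gen[of 1] assms by (simp add: gen_1_eq_twist[unfolded One_nat_def])
  show "twist (transpose (q+2) (q+4)) \<in> R J"
    using twist_transpose_gen[OF *, of 2] assms by simp
qed

lemma twist_in_R12:
  assumes "s permutes {q+2, q+3, q+4}"
  shows "twist s \<in> R {1,2}"
proof (rule twist_star_in_R[OF _ _ assms])
  show "twist (transpose (q+2) b) \<in> R {1,2}" if "b \<in> {q+3, q+4}" for b
    using that twist_12[OF order.refl] by (auto simp only: insert_iff empty_iff)
qed auto

text \<open>Conjugation by \<open>\<rho>\<^sub>3\<close> carries \<open>q+4\<close> to
  \<open>q+5\<close>, which supplies the last transposition of the star at
  \<open>q+2\<close>.\<close>

lemma twist_in_R123: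
  assumes "s permutes {q+2, q+3, q+4, q+5}"
  shows "twist s \<in> R {1,2,3}"
proof (rule twist_star_in_R[OF _ _ assms])
  have *: "{1,2} \<subseteq> {1,2,3::nat}" by simp
  have "twist (transpose (gen q 3 (q+2)) (gen q 3 (q+4))) \<in> R {1,2,3}"
    by (rule twist_transpose_gen[OF twist_12(2)[OF *]]) auto
  then have **: "twist (transpose (q+2) (q+5)) \<in> R {1,2,3}" by simp
  show "twist (transpose (q+2) b) \<in> R {1,2,3}" if "b \<in> {q+3, q+4, q+5}" for b
    using that twist_12[OF *] ** by (auto simp only: insert_iff empty_iff)
qed auto

section \<open>Dihedral parabolic subgroups and their intersections\<close>

abbreviation words :: "(nat \<Rightarrow> nat) \<Rightarrow> (nat \<Rightarrow> nat) \<Rightarrow> (nat \<Rightarrow> nat) set" where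
  "words a b \<equiv> {id, a, b, a \<circ> b, b \<circ> a, a \<circ> b \<circ> a, b \<circ> a \<circ> b, a \<circ> b \<circ> a \<circ> b, b \<circ> a \<circ> b \<circ> a,
     a \<circ> b \<circ> a \<circ> b \<circ> a, b \<circ> a \<circ> b \<circ> a \<circ> b, a \<circ> b \<circ> a \<circ> b \<circ> a \<circ> b}"

text \<open>The braid relation identifies the two alternating words of length six, so
  \<open>words\<close> lists only one of them, and left multiplication by either generator stays
  within the list.\<close>

lemma dihedral_words:
  assumes g: "g \<in> R {i,j}" and ij: "i < 5" "j < 5"
    and braid: "gen q i \<circ> gen q j \<circ> gen q i \<circ> gen q j \<circ> gen q i \<circ> gen q j =
      gen q j \<circ> gen q i \<circ> gen q j \<circ> gen q i \<circ> gen q j \<circ> gen q i"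
  shows "g \<in> words (gen q i) (gen q j)"
proof -
  define a b where "a = gen q i" and "b = gen q j"
  have a: "a (a x) = x" and b: "b (b x) = x" for x
    using gen_involution[OF ij(1)] gen_involution[OF ij(2)] by (auto simp: a_def b_def fun_eq_iff)
  have ab: "a (b (a (b (a (b x))))) = b (a (b (a (b (a x)))))" for x
    using fun_cong[OF braid, of x] by (simp add: a_def b_def)
  have A: "a \<circ> (a \<circ> h) = h" "b \<circ> (b \<circ> h) = h" for h :: "nat \<Rightarrow> nat"
    by (auto simp: fun_eq_iff a b)
  \<comment> \<open>\<open>B\<close> and \<open>B'\<close> are the two products, reaching length six
    and falling back from it, for which cancelling a repeated letter is not enough.\<close>
  have B: "b \<circ> (a \<circ> (b \<circ> (a \<circ> (b \<circ> a)))) = a \<circ> (b \<circ> (a \<circ> (b \<circ> (a \<circ> b))))"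
    by (simp add: fun_eq_iff ab)
  have B': "b \<circ> (a \<circ> (b \<circ> (a \<circ> (b \<circ> (a \<circ> b))))) = a \<circ> (b \<circ> (a \<circ> (b \<circ> a)))"
    by (simp add: fun_eq_iff ab[symmetric] b)
  have aa: "a \<circ> a = id" "b \<circ> b = id" by (auto simp: fun_eq_iff a b)
  from g have "g \<in> words a b"
  proof (induction rule: R_induct)
    case subset
    show ?case using ij by simp
  next
    case (mult k h)
    have "gen q k = a \<or> gen q k = b" using mult(1) by (auto simp: a_def b_def)
    moreover have "a \<circ> h \<in> words a b"
      using mult.IH unfolding comp_assoc insert_iff empty_iff
      by (elim disjE; simp only: comp_assoc A aa comp_id simp_thms)
    moreover have "b \<circ> h \<in> words a b"
      using mult.IH unfolding comp_assoc insert_iff empty_iff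
      by (elim disjE; simp only: comp_assoc A aa comp_id simp_thms B B')
    ultimately show ?case by (elim disjE) (simp_all only:)
  qed auto
  then show ?thesis unfolding a_def b_def .
qed

lemma gen_1_table [simp]:
  "gen q (Suc 0) (Suc (Suc q)) = q+3" "gen q (Suc 0) (q+3) = Suc (Suc q)"
  "gen q (Suc 0) (q+4) = q+4" "gen q (Suc 0) (q+5) = q+5" "gen q (Suc 0) (q+6) = q+6"
  "gen q (Suc 0) (q+7) = q+7" "gen q (Suc 0) (q+8) = q+8" "gen q (Suc 0) (q+9) = q+9"
  "gen q (Suc 0) (q+10) = q+10" "gen q (Suc 0) (q+11) = q+11" "gen q (Suc 0) (q+12) = q+12"
  "gen q (Suc 0) (q+13) = q+13"
  using even_q by (simp_all add: gen_1_apply[unfolded One_nat_def])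

lemma gen_1_low: "i \<le> q + 1 \<Longrightarrow> gen q 1 i = tau i"
  unfolding gen_1_apply tau_apply by auto

lemma gen_above: 
  assumes "k < 5" "i > q + 13"
  shows "gen q k i = i"
  using permutes_not_in[OF gen_permutes[OF assms(1)], of i] assms(2) by simp

lemma braid_23:
  "gen q 2 \<circ> gen q 3 \<circ> gen q 2 \<circ> gen q 3 \<circ> gen q 2 \<circ> gen q 3 =
   gen q 3 \<circ> gen q 2 \<circ> gen q 3 \<circ> gen q 2 \<circ> gen q 3 \<circ> gen q 2" (is "?f = ?g")
proof
  fix x
  show "?f x = ?g x" using points_cases[of x] by (elim disjE; simp)
qed

text \<open>On vertices up to \<open>q+1\<close>, \<open>\<rho>\<^sub>2\<close> is trivial and
  \<open>\<rho>\<^sub>1\<close> is \<open>tau\<close>, so both sides apply \<open>tau\<close> three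
  times; the tail is a finite check.\<close>

lemma braid_12:
  "gen q 1 \<circ> gen q 2 \<circ> gen q 1 \<circ> gen q 2 \<circ> gen q 1 \<circ> gen q 2 =
   gen q 2 \<circ> gen q 1 \<circ> gen q 2 \<circ> gen q 1 \<circ> gen q 2 \<circ> gen q 1" (is "?f = ?g")
proof
  fix x
  consider "x \<le> q + 1" | "x \<in> Y" | "x > q + 13" by fastforce
  then show "?f x = ?g x"
  proof cases
    case 1
    have t: "tau x \<le> q + 1" "tau (tau x) = x"
      using tau_le[OF 1] fun_cong[OF tau_involution] by simp_all
    have "gen q 2 y = y" if "y \<le> q + 1" for y using that by simp
    then show ?thesis using 1 t by (simp add: gen_1_low del: One_nat_def)
  next
    case 2
    then show ?thesis using points_cases[of x] by (elim disjE; simp)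
  next
    case 3
    then show ?thesis by (simp add: gen_above)
  qed
qed

lemma R_fixes:
  assumes "g \<in> R J" "J \<subseteq> {..<5}" "\<And>k. k \<in> J \<Longrightarrow> gen q k i = i"
  shows "g i = i"
  using assms(1,2)
proof (induction rule: parabolic_induct)
  case (mult k h)
  then show ?case using assms(3) by simp
qed simp

lemma R_preserves:
  assumes "g \<in> R J" "J \<subseteq> {..<5}" "\<And>k x. k \<in> J \<Longrightarrow> x \<in> X \<Longrightarrow> gen q k x \<in> X" "i \<in> X"
  shows "g i \<in> X"
  using assms(1,2)
proof (induction rule: parabolic_induct)
  case (mult k h)
  then show ?case using assms(3) by simp
qed (simp add: assms(4))

text \<open>\<open>q+10\<close> detects the parity of the number of letters
  \<open>\<rho>\<^sub>2\<close>; among the words with an even number, fixing \<open>q+4\<close>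
  leaves only \<open>id\<close> and \<open>\<rho>\<^sub>1\<close>.\<close>

lemma intersection_01_12: "g \<in> R {0,1} \<Longrightarrow> g \<in> R {1,2} \<Longrightarrow> g \<in> R {1}"
proof -
  assume g: "g \<in> R {0,1}" "g \<in> R {1,2}"
  have "g (q+4) = q+4" "g (q+10) = q+10"
    by (rule R_fixes[OF g(1)]; auto simp: gen_0_apply)+
  moreover have "g \<in> words (gen q 1) (gen q 2)"
    by (rule dihedral_words[OF g(2) _ _ braid_12]) auto
  ultimately have "g = id \<or> g = gen q 1"
    unfolding insert_iff empty_iff by (elim disjE; simp)
  then show ?thesis using R_id[of "{1}"] R_gen[of 1 "{1}"]
    by (elim disjE) (simp_all only: insert_iff simp_thms)
qed

text \<open>Vertex \<open>2\<close>, exchanged with \<open>3\<close> by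
  \<open>\<rho>\<^sub>1\<close> and fixed by \<open>\<rho>\<^sub>2\<close>, detects the parity of
  the letters \<open>\<rho>\<^sub>1\<close>; fixing \<open>q+2\<close> does the rest.\<close>

lemma intersection_12_23: "g \<in> R {1,2} \<Longrightarrow> g \<in> R {2,3} \<Longrightarrow> g \<in> R {2}"
proof -
  assume g: "g \<in> R {1,2}" "g \<in> R {2,3}"
  have "g (Suc (Suc q)) = Suc (Suc q)" "g 2 = 2"
    by (rule R_fixes[OF g(2)]; use q_ge_2 in auto)+
  moreover have "g \<in> words (gen q 1) (gen q 2)"
    by (rule dihedral_words[OF g(1) _ _ braid_12]) auto
  moreover have "gen q 1 2 = 3" "gen q 1 3 = 2" "gen q 2 2 = 2" "gen q 2 3 = 3"
    using q_ge_2 by (simp_all add: gen_1_apply del: One_nat_def)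
  ultimately have "g = id \<or> g = gen q 2"
    unfolding insert_iff empty_iff by (elim disjE; simp)
  then show ?thesis using R_id[of "{2}"] R_gen[of 2 "{2}"]
    by (elim disjE) (simp_all only: insert_iff simp_thms)
qed

text \<open>\<open>\<rho>\<^sub>3\<close> and \<open>\<rho>\<^sub>4\<close> preserve the vertices
  \<open>u\<^sub>1,\<dots>,u\<^sub>5\<close>, whereas a word with an odd number of letters
  \<open>\<rho>\<^sub>2\<close> sends \<open>q+8\<close> to \<open>q+13\<close>.\<close>

lemma intersection_23_34: "g \<in> R {2,3} \<Longrightarrow> g \<in> R {3,4} \<Longrightarrow> g \<in> R {3}"
proof -
  assume g: "g \<in> R {2,3}" "g \<in> R {3,4}"
  have "g (q+3) = q+3"
    by (rule R_fixes[OF g(2)]) auto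
  moreover have "g (q+8) \<in> {q+4,q+5,q+6,q+7,q+8}"
    by (rule R_preserves[OF g(2)]) auto
  moreover have "g \<in> words (gen q 2) (gen q 3)"
    by (rule dihedral_words[OF g(1) _ _ braid_23]) auto
  ultimately have "g = id \<or> g = gen q 3"
    unfolding insert_iff empty_iff by (elim disjE; simp)
  then show ?thesis using R_id[of "{3}"] R_gen[of 3 "{3}"]
    by (elim disjE) (simp_all only: insert_iff simp_thms)
qed

section \<open>Action on the last eight vertices\<close>

abbreviation Z :: "nat set" where "Z \<equiv> {q+6,q+7,q+8,q+9,q+10,q+11,q+12,q+13}"

lemma R23_Z: "d \<in> R {2,3} \<Longrightarrow> z \<in> Z \<Longrightarrow> d z \<in> Z"
  by (rule R_preserves[of d "{2,3}" Z z]) auto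

text \<open>\<open>\<rho>\<^sub>0\<close> and \<open>\<rho>\<^sub>1\<close> fix \<open>Z\<close>
  pointwise and the other two generators preserve it, so deleting the letters
  \<open>\<rho>\<^sub>0, \<rho>\<^sub>1\<close> from a word does not change its action
  there.\<close>

lemma R0123_Z:
  assumes "g \<in> R {0,1,2,3}"
  shows "\<exists>d\<in>R {2,3}. \<forall>z\<in>Z. g z = d z"
  using assms
proof (induction rule: R_induct)
  case one
  then show ?case using R_id by blast
next
  case (mult k h)
  then obtain d where d: "d \<in> R {2,3}" "\<forall>z\<in>Z. h z = d z" by blast
  show ?case
  proof (cases "k \<in> {2,3}")
    case True
    then have "gen q k \<circ> d \<in> R {2,3}" using R_comp[OF R_gen d(1)] by blast
    then show ?thesis using d(2) by (intro bexI[of _ "gen q k \<circ> d"]) auto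
  next
    case False
    then have "k = 0 \<or> k = 1" using mult by auto
    then have "gen q k z = z" if "z \<in> Z" for z
      using that by (auto simp: gen_0_apply)
    then show ?thesis using d R23_Z by (intro bexI[OF _ d(1)]) auto
  qed
qed simp

text \<open>Dividing \<open>g\<close> by the dihedral element with the same action on
  \<open>Z\<close> leaves a twist that fixes \<open>Z\<close> pointwise, which confines its tail
  part to four points.\<close>

lemma R0123_R1234:
  assumes g: "g \<in> R {0,1,2,3}" "g \<in> R {1,2,3,4}"
  obtains s d where "d \<in> R {2,3}" "s permutes {q+2,q+3,q+4,q+5}" "g = twist s \<circ> d"
proof -
  obtain d where d: "d \<in> R {2,3}" "\<forall>z\<in>Z. g z = d z" using R0123_Z[OF g(1)] by blast
  have d': "inv' d \<in> R {2,3}" "inv' d \<circ> d = id" "d \<circ> inv' d = id"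
    using R_inv[OF _ d(1)] R_inv_comp[OF _ d(1)] by simp_all
  have "inv' d \<in> R {1,2,3,4}" by (rule R_mono[OF _ d'(1)]) auto
  then have "g \<circ> inv' d \<in> R {1,2,3,4}" using R_comp g(2) by blast
  then obtain s where s: "s permutes Y" "g \<circ> inv' d = twist s" using R1234_twist by blast
  have sz: "s z = z" if "z \<in> Z" for z
  proof -
    have "z \<ge> q + 2" using that by auto
    then have "s z = twist s z" by (simp add: twist_def tau_tail)
    also have "\<dots> = g (inv' d z)" using s(2) by (metis comp_apply)
    also have "\<dots> = d (inv' d z)" using d(2) R23_Z[OF d'(1) that] by blast
    also have "\<dots> = z" using d'(3) by (metis comp_apply id_apply)
    finally show ?thesis .
  qed
  have "s permutes {q+2,q+3,q+4,q+5}"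
  proof (rule permutes_superset[OF s(1)])
    fix x assume "x \<in> Y - {q+2,q+3,q+4,q+5}"
    then have "x \<in> Z" using tail_points by blast
    then show "s x = x" by (rule sz)
  qed
  moreover have "g = twist s \<circ> d"
    using s(2) d'(2) by (metis comp_assoc comp_id)
  ultimately show ?thesis using that d(1) by blast
qed

lemma twist_Z: 
  assumes "s permutes {q+2,q+3,q+4,q+5}" "z \<in> Z"
  shows "twist s z = z"
proof -
  have "z \<ge> q + 2" "z \<notin> {q+2,q+3,q+4,q+5}" using assms(2) by auto
  then show ?thesis using permutes_not_in[OF assms(1)] by (simp add: twist_def tau_tail)
qed

lemma intersection_0123_1234:
  assumes "g \<in> R {0,1,2,3}" "g \<in> R {1,2,3,4}"
  shows "g \<in> R {1,2,3}"
proof -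
  obtain s d where "d \<in> R {2,3}" "s permutes {q+2,q+3,q+4,q+5}" "g = twist s \<circ> d"
    by (rule R0123_R1234[OF assms])
  moreover have "d \<in> R {1,2,3}" by (rule R_mono[OF _ \<open>d \<in> R {2,3}\<close>]) auto
  ultimately show ?thesis using R_comp[OF twist_in_R123] by blast
qed

text \<open>\<open>g\<close> and the twist fix \<open>q+6\<close>, so \<open>d\<close> does too. The
  orbit of \<open>q+6\<close> under \<open>\<langle>\<rho>\<^sub>2,\<rho>\<^sub>3\<rangle>\<close>
  has six points, which leaves \<open>id\<close> and \<open>\<rho>\<^sub>2\<close> for
  \<open>d\<close>; both fix \<open>q+5\<close>, hence so does \<open>s\<close>.\<close>

lemma intersection_012_123:
  assumes g: "g \<in> R {0,1,2}" "g \<in> R {1,2,3}"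
  shows "g \<in> R {1,2}"
proof -
  obtain s d where d: "d \<in> R {2,3}" and s: "s permutes {q+2,q+3,q+4,q+5}" and eq: "g = twist s \<circ> d"
  proof (rule R0123_R1234)
    show "g \<in> R {0,1,2,3}" by (rule R_mono[OF _ g(1)]) auto
    show "g \<in> R {1,2,3,4}" by (rule R_mono[OF _ g(2)]) auto
  qed
  have g_fix: "g (q+5) = q+5" "g (q+6) = q+6"
    by (rule R_fixes[OF g(1)]; auto simp: gen_0_apply)+
  have "d (q+6) \<in> Z" by (rule R23_Z[OF d]) simp
  then have "d (q+6) = q+6" using g_fix(2) twist_Z[OF s, of "d (q+6)"] unfolding eq by simp
  moreover have "d \<in> words (gen q 2) (gen q 3)"
    by (rule dihedral_words[OF d _ _ braid_23]) auto
  ultimately have d2: "d = id \<or> d = gen q 2"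
    unfolding insert_iff empty_iff by (elim disjE; simp)
  then have "d (q+5) = q+5" by auto
  then have "s (q+5) = q+5" using g_fix(1) unfolding eq by (auto simp: twist_def tau_tail split: if_splits)
  then have "s permutes {q+2,q+3,q+4}"
    by (intro permutes_superset[OF s]) auto
  then have "twist s \<in> R {1,2}" by (rule twist_in_R12)
  moreover have "d \<in> R {1,2}" using d2 R_id[of "{1,2}"] R_gen[of 2 "{1,2}"]
    by (elim disjE) (simp_all only: insert_iff simp_thms)
  ultimately show ?thesis unfolding eq by (rule R_comp)
qed

end

text \<open>Vertex \<open>q + i\<close> is represented by \<open>i\<close>. Distinct blocks share exactly two points, so exchanging a
  single point of a block never gives a block.\<close>

definition biplane :: "nat list list" where
  "biplane = [[3,4,7,11,13], [3,4,8,10,12], [3,5,6,12,13], [3,5,8,9,11], [3,6,7,9,10], [4,5,6,7,8],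
     [4,5,9,10,13], [4,6,9,11,12], [5,7,10,11,12], [6,8,10,11,13], [7,8,9,12,13]]"

text \<open>Sorting gives each image the form in which blocks are listed, so invariance is a finite
  computation at \<open>q = 0\<close>; \<open>gen_shift\<close> transports it to other
  \<open>q\<close>.\<close>

lemma gen_biplane: "\<forall>k\<in>{2,3,4}. \<forall>B\<in>set biplane. sort (map (gen 0 k) B) \<in> set biplane"
  by (simp add: biplane_def gen_tail_simps)

lemma transpose_shift: "transpose (q + a) (q + b) (q + i) = q + transpose a b (i :: nat)"
  by (simp add: transpose_def)

lemma gen_shift: "k \<in> {2,3,4} \<Longrightarrow> gen q k (q + i) = q + gen 0 k i"
  by (auto simp: gen_tail_simps transpose_shift)

context pentagon_graph
begin

lemma R234_biplane:
  assumes "g \<in> R {2,3,4}" "B \<in> set biplane"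
  shows "\<exists>B'\<in>set biplane. g ` (+) q ` set B = (+) q ` set B'"
  using assms(1)
proof (induction rule: R_induct)
  case one
  then show ?case using assms(2) by (intro bexI[of _ B]) auto
next
  case (mult k h)
  then obtain B' where B': "B' \<in> set biplane" "h ` (+) q ` set B = (+) q ` set B'" by blast
  have "gen q k ` (+) q ` set B' = (+) q ` gen 0 k ` set B'"
    unfolding image_image gen_shift[OF mult(1)] ..
  also have "\<dots> = (+) q ` set (sort (map (gen 0 k) B'))" by (simp only: set_sort set_map)
  finally have "gen q k ` h ` (+) q ` set B = (+) q ` set (sort (map (gen 0 k) B'))"
    unfolding B'(2) .
  then have "(gen q k \<circ> h) ` (+) q ` set B = (+) q ` set (sort (map (gen 0 k) B'))"
    unfolding image_comp[symmetric] .
  then show ?case by (rule bexI) (use gen_biplane mult(1) B'(1) in blast)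
qed simp

text \<open>For each of \<open>3, 4, 5\<close> a block is chosen that meets \<open>{3,4,5}\<close>
  in that point alone. Its other four points are fixed, so moving the remaining one would exchange a
  single point of a block.\<close>

lemma R234_triple_support_id:
  assumes g: "g \<in> R {2,3,4}" and p: "g permutes {q+3, q+4, q+5}"
  shows "g = id"
proof -
  have fix_out: "g (q+6) = q+6" "g (q+7) = q+7" "g (q+9) = q+9" "g (q+10) = q+10" "g (q+11) = q+11" "g (q+12) = q+12"
    by (simp_all add: permutes_not_in[OF p])
  have im: "\<exists>j\<in>{3,4,5}. g (q+i) = q+j" if "i \<in> {3,4,5}" for i
    using permutes_in_image[OF p, of "q+i"] that by auto
  have inj: "(+) q ` A = (+) q ` B \<longleftrightarrow> A = B" for A B
    by (rule inj_image_eq_iff) simp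
  have *: "insert j C \<in> set ` set biplane"
    if t: "g (q+i) = q+j" "i # xs \<in> set biplane" "\<forall>x\<in>C. g (q+x) = q+x" "C = set xs" for i j C xs
  proof -
    have "g ` (+) q ` set (i # xs) = (+) q ` insert j C"
      using t by (auto simp: image_iff)
    then obtain B' where "B' \<in> set biplane" "(+) q ` insert j C = (+) q ` set B'"
      using R234_biplane[OF g t(2)] by metis
    then show ?thesis unfolding inj by blast
  qed
  have "g (q+3) = q+3"
  proof -
    obtain j where j: "j \<in> {3,4,5}" "g (q+3) = q+j" using im[of 3] by auto
    have "insert j {6,7,9,10} \<in> set ` set biplane"
      by (rule *[OF j(2), of "[6,7,9,10]"]) (auto simp: biplane_def fix_out)
    then show ?thesis using j by (auto simp: biplane_def set_eq_subset)
  qed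
  moreover have "g (q+4) = q+4"
  proof -
    obtain j where j: "j \<in> {3,4,5}" "g (q+4) = q+j" using im[of 4] by auto
    have "insert j {6,9,11,12} \<in> set ` set biplane"
      by (rule *[OF j(2), of "[6,9,11,12]"]) (auto simp: biplane_def fix_out)
    then show ?thesis using j by (auto simp: biplane_def set_eq_subset)
  qed
  moreover have "g (q+5) = q+5"
  proof -
    obtain j where j: "j \<in> {3,4,5}" "g (q+5) = q+j" using im[of 5] by auto
    have "insert j {7,10,11,12} \<in> set ` set biplane"
      by (rule *[OF j(2), of "[7,10,11,12]"]) (auto simp: biplane_def fix_out)
    then show ?thesis using j by (auto simp: biplane_def set_eq_subset)
  qed
  ultimately have "g permutes {}"
    by (intro permutes_superset[OF p]) auto
  then show ?thesis by simp
qed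

text \<open>The twist left after removing \<open>d\<close> lies in
  \<open>\<langle>\<rho>\<^sub>2,\<rho>\<^sub>3,\<rho>\<^sub>4\<rangle>\<close>. It fixes vertex
  \<open>2\<close>, so it is even, and it fixes \<open>q+2\<close>, so it is supported on three
  points and the biplane makes it trivial.\<close>

lemma intersection_123_234:
  assumes g: "g \<in> R {1,2,3}" "g \<in> R {2,3,4}"
  shows "g \<in> R {2,3}"
proof -
  obtain s d where d: "d \<in> R {2,3}" and s: "s permutes {q+2,q+3,q+4,q+5}" and eq: "g = twist s \<circ> d"
  proof (rule R0123_R1234)
    show "g \<in> R {0,1,2,3}" by (rule R_mono[OF _ g(1)]) auto
    show "g \<in> R {1,2,3,4}" by (rule R_mono[OF _ g(1)]) auto
  qed
  have d': "inv' d \<in> R {2,3}" "d \<circ> inv' d = id"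
    using R_inv[OF _ d] R_inv_comp[OF _ d] by simp_all
  have "inv' d \<in> R {2,3,4}" by (rule R_mono[OF _ d'(1)]) auto
  with g(2) have "g \<circ> inv' d \<in> R {2,3,4}" by (rule R_comp)
  moreover have "g \<circ> inv' d = twist s" unfolding eq comp_assoc d'(2) by simp
  ultimately have t: "twist s \<in> R {2,3,4}" by (simp only:)
  have fx: "twist s (q+2) = q+2" "twist s 2 = 2"
    by (rule R_fixes[OF t]; use q_ge_2 in auto)+
  have "tau 2 = 3" using q_ge_2 by (simp add: tau_apply)
  \<comment> \<open>For odd \<open>s\<close> the twist would send \<open>2\<close> to
    \<open>s 3\<close>, contradicting that it fixes \<open>2\<close>.\<close>
  moreover have "s 3 \<noteq> 2"
  proof -
    have "s 2 = 2" by (rule permutes_not_in[OF s]) (use q_ge_2 in auto)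
    then show ?thesis using inj_eq[OF permutes_inj[OF s], of 3 2] by auto
  qed
  ultimately have "evenperm s" using fx(2) by (auto simp: twist_def split: if_splits)
  then have ts: "twist s = s" by (simp add: twist_def)
  have "s permutes {q+3,q+4,q+5}"
    using fx(1) unfolding ts by (intro permutes_superset[OF s]) auto
  then have "twist s = id" using R234_triple_support_id[OF t[unfolded ts]] ts by simp
  then show ?thesis unfolding eq using d by (simp only: id_comp)
qed

section \<open>Assembling the intersection property\<close>

lemma R_singleton:
  assumes "g \<in> R {k}" "k < 5"
  shows "g = id \<or> g = gen q k"
  using assms(1)
proof (induction rule: R_induct)
  case (mult j h)
  then show ?case using gen_involution[OF assms(2)] by (metis comp_id singletonD)
qed (use assms in auto)

lemma R_disjoint:
  assumes "i < 5" "j < 5" "gen q i \<noteq> gen q j" "g \<in> R {i}" "g \<in> R {j}"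
  shows "g \<in> R {}"
proof -
  have "g = id" using assms R_singleton by metis
  then show ?thesis using R_id by (simp only:)
qed

lemma gen_distinct: "gen q 0 \<noteq> gen q 1" "gen q 1 \<noteq> gen q 2" "gen q 2 \<noteq> gen q 3" "gen q 3 \<noteq> gen q 4"
proof -
  show "gen q 0 \<noteq> gen q 1"
    by (rule notI, drule fun_cong[of _ _ 1]) (simp add: gen_0_apply gen_1_apply del: One_nat_def)
  show "gen q 1 \<noteq> gen q 2" by (rule notI, drule fun_cong[of _ _ "q+2"]) simp
  show "gen q 2 \<noteq> gen q 3" by (rule notI, drule fun_cong[of _ _ "q+3"]) simp
  show "gen q 3 \<noteq> gen q 4" by (rule notI, drule fun_cong[of _ _ "q+4"]) simp
qed

text \<open>Intervals of indices are treated by increasing length, each from its two subintervals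
  that are shorter by one.\<close>

lemma intersection_property_gen: "intersection_property_on (sym_group n) (gen q) {..<5}"
proof -
  let ?IP = "intersection_property_on (sym_group n) (gen q)"
  \<comment> \<open>The index sets are variables tied to intervals by equations, so that explicit
    sets such as \<open>{1,2,3}\<close> can be supplied.\<close>
  have step: "?IP I"
    if "\<And>g. g \<in> R A \<Longrightarrow> g \<in> R B \<Longrightarrow> g \<in> R C" "?IP A" "?IP B" "a \<le> b" "b < 5"
      "A = {a..<b}" "B = {a<..b}" "C = {a<..<b}" "I = {a..b}" for a b A B C I
    unfolding that(9)
    by (rule intersection_interval[OF that(4,5) that(2,3)[unfolded that(6,7)]])
      (use that(1)[unfolded that(6-8)] in blast)
  have "?IP {}" by (simp add: intersection_property_on_def)
  note 0 = step[OF _ this this]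
  have 1: "?IP {0}" "?IP {1}" "?IP {2}" "?IP {3}" "?IP {4}"
  proof -
    show "?IP {0}" by (rule 0[where a = 0 and b = 0]) auto
    show "?IP {1}" by (rule 0[where a = 1 and b = 1]) auto
    show "?IP {2}" by (rule 0[where a = 2 and b = 2]) auto
    show "?IP {3}" by (rule 0[where a = 3 and b = 3]) auto
    show "?IP {4}" by (rule 0[where a = 4 and b = 4]) auto
  qed
  have 2: "?IP {0,1}" "?IP {1,2}" "?IP {2,3}" "?IP {3,4}"
  proof -
    show "?IP {0,1}"
      by (rule step[OF R_disjoint[OF _ _ gen_distinct(1)] 1(1,2), where a = 0 and b = 1]) auto
    show "?IP {1,2}"
      by (rule step[OF R_disjoint[OF _ _ gen_distinct(2)] 1(2,3), where a = 1 and b = 2]) auto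
    show "?IP {2,3}"
      by (rule step[OF R_disjoint[OF _ _ gen_distinct(3)] 1(3,4), where a = 2 and b = 3]) auto
    show "?IP {3,4}"
      by (rule step[OF R_disjoint[OF _ _ gen_distinct(4)] 1(4,5), where a = 3 and b = 4]) auto
  qed
  have 3: "?IP {0,1,2}"
    by (rule step[OF intersection_01_12 2(1,2), where a = 0 and b = 2]) auto
  have 4: "?IP {1,2,3}"
    by (rule step[OF intersection_12_23 2(2,3), where a = 1 and b = 3]) auto
  have 5: "?IP {2,3,4}"
    by (rule step[OF intersection_23_34 2(3,4), where a = 2 and b = 4]) auto
  have 6: "?IP {0,1,2,3}"
    by (rule step[OF intersection_012_123 3 4, where a = 0 and b = 3]) auto
  have 7: "?IP {1,2,3,4}"
    by (rule step[OF intersection_123_234 4 5, where a = 1 and b = 4]) auto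
  show ?thesis
    by (rule step[OF intersection_0123_1234 6 7, where a = 0 and b = 4]) auto
qed

end

section \<open>Generation of the alternating group\<close>

abbreviation three_cycle :: "'a \<Rightarrow> 'a \<Rightarrow> 'a \<Rightarrow> 'a \<Rightarrow> 'a" where
  "three_cycle a b c \<equiv> transpose a b \<circ> transpose b c"

lemma three_cycle_rotate:
  "distinct [a, b, c] \<Longrightarrow> three_cycle a b c = three_cycle b c a"
  by (auto simp: fun_eq_iff transpose_def)

lemma three_cycle_square:
  "distinct [a, b, c] \<Longrightarrow> three_cycle a b c \<circ> three_cycle a b c = three_cycle b a c"
  by (auto simp: fun_eq_iff transpose_def)

lemma three_cycle_conj:
  "distinct [a, b, y, v] \<Longrightarrow>
    three_cycle a b y \<circ> three_cycle a b v \<circ> three_cycle y b a = three_cycle b y v"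
  by (auto simp: fun_eq_iff transpose_def)

lemma three_cycle_conj_involution:
  assumes "f \<circ> f = id" "f a = a" "f b = b"
  shows "f \<circ> three_cycle a b s \<circ> f = three_cycle a b (f s)"
proof -
  have f: "f (f x) = x" for x using assms(1) by (simp add: fun_eq_iff)
  have "f \<circ> three_cycle a b s \<circ> f = (f \<circ> transpose a b \<circ> f) \<circ> (f \<circ> transpose b s \<circ> f)"
    by (simp add: fun_eq_iff f)
  also have "\<dots> = three_cycle a b (f s)"
    unfolding transpose_conj_involution[OF assms(1)] assms(2,3) ..
  finally show ?thesis .
qed

definition contains_three_cycles :: "('a \<Rightarrow> 'a) set \<Rightarrow> 'a set \<Rightarrow> bool" where
  "contains_three_cycles H S \<longleftrightarrow>
    (\<forall>a\<in>S. \<forall>b\<in>S. \<forall>c\<in>S. distinct [a, b, c] \<longrightarrow> three_cycle a b c \<in> H)"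

text \<open>A single 3-cycle through \<open>v\<close> and two points of \<open>S\<close> suffices:
  squaring it and conjugating it by 3-cycles on \<open>S\<close> yields all the others through
  \<open>v\<close>.\<close>

lemma contains_three_cycles_insert:
  assumes closed: "\<And>g h. g \<in> H \<Longrightarrow> h \<in> H \<Longrightarrow> g \<circ> h \<in> H"
    and S: "contains_three_cycles H S"
    and ab: "a \<in> S" "b \<in> S" "a \<noteq> b" and v: "three_cycle a b v \<in> H"
  shows "contains_three_cycles H (insert v S)"
proof (cases "v \<in> S")
  case True
  then show ?thesis using S by (simp only: insert_absorb)
next
  case False
  define P where "P x y \<longleftrightarrow> three_cycle x y v \<in> H" for x y
  have flip: "P y x" if "P x y" "x \<in> S" "y \<in> S" "x \<noteq> y" for x y
  proof -
    have "distinct [x, y, v]" using that False by auto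
    from three_cycle_square[OF this] closed show ?thesis using that(1) unfolding P_def by metis
  qed
  have shift: "P y z" if "P x y" "x \<in> S" "y \<in> S" "z \<in> S" "distinct [x, y, z]" for x y z
  proof -
    have "distinct [x, y, z, v]" using that False by auto
    moreover have "three_cycle x y z \<in> H" "three_cycle z y x \<in> H"
      using S that unfolding contains_three_cycles_def by auto
    ultimately show ?thesis using three_cycle_conj closed that(1) unfolding P_def by metis
  qed
  \<comment> \<open>The point \<open>b\<close> serves as a pivot: every pair is then reached from a
    pair containing \<open>b\<close>.\<close>
  have Pb: "P b z" if "z \<in> S" "z \<noteq> b" for z
    using v flip[of a b] shift[of a b z] ab that unfolding P_def[symmetric] by (cases "z = a") auto
  have P: "P x y" if "x \<in> S" "y \<in> S" "x \<noteq> y" for x y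
  proof (cases "x = b")
    case False
    then have "P x b" "P b x" using Pb flip ab that by auto
    then show ?thesis using shift[of b x y] ab that False by (cases "y = b") auto
  qed (use Pb that in auto)
  show ?thesis
    unfolding contains_three_cycles_def
  proof (intro ballI impI)
    fix x y z assume xyz: "x \<in> insert v S" "y \<in> insert v S" "z \<in> insert v S" "distinct [x, y, z]"
    then consider "x = v" "y \<in> S" "z \<in> S" | "y = v" "z \<in> S" "x \<in> S" | "z = v" "x \<in> S" "y \<in> S"
      | "x \<in> S" "y \<in> S" "z \<in> S" by auto
    then show "three_cycle x y z \<in> H"
    proof cases
      case 1
      then have "three_cycle y z x \<in> H" using P xyz(4) unfolding P_def by simp
      then show ?thesis using three_cycle_rotate[OF xyz(4)] by (simp only:)
    next
      case 2
      then have "three_cycle z x y \<in> H" using P[of z x] xyz(4) unfolding P_def by auto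
      moreover have "distinct [z, x, y]" using xyz(4) by auto
      ultimately show ?thesis using three_cycle_rotate[of z x y] by (simp only:)
    next
      case 3
      then show ?thesis using P xyz(4) unfolding P_def by simp
    next
      case 4
      then show ?thesis using S xyz(4) unfolding contains_three_cycles_def by blast
    qed
  qed
qed

section \<open>Spreading 3-cycles along the edges of the graph\<close>

context pentagon_graph
begin

abbreviation full :: "nat set \<Rightarrow> bool" where
  "full S \<equiv> contains_three_cycles (R {..<5}) S"

text \<open>Conjugation by a generator that fixes the anchors \<open>a\<close> and \<open>b\<close>
  only replaces the third point of the cycle.\<close>

lemma full_insert:
  assumes "full S" "k < 5" "{a, b, s} \<subseteq> S" "distinct [a, b, s]" "gen q k a = a" "gen q k b = b"
  shows "full (insert (gen q k s) S)"
proof (rule contains_three_cycles_insert[OF R_comp assms(1), of a b])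
  have mem: "three_cycle a b s \<in> R {..<5}" "gen q k \<in> R {..<5}"
    using assms R_gen unfolding contains_three_cycles_def by auto
  show "three_cycle a b (gen q k s) \<in> R {..<5}"
    unfolding three_cycle_conj_involution[OF gen_involution[OF assms(2)] assms(5,6), symmetric]
    by (rule R_comp[OF R_comp[OF mem(2,1)] mem(2)])
qed (use assms in auto)

text \<open>A 3-cycle is even, so it equals its own twist, and the twists on these four points are
  already available.\<close>

lemma full_path_end: "full {q+2, q+3, q+4, q+5}"
  unfolding contains_three_cycles_def
proof (intro ballI impI)
  fix a b c assume S: "a \<in> {q+2, q+3, q+4, q+5}" "b \<in> {q+2, q+3, q+4, q+5}" "c \<in> {q+2, q+3, q+4, q+5}"
    and d: "distinct [a, b, c]"
  have "three_cycle a b c permutes {q+2, q+3, q+4, q+5}"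
    by (rule permutes_compose[OF permutes_swap_id[OF S(2,3)] permutes_swap_id[OF S(1,2)]])
  then have "twist (three_cycle a b c) \<in> R {1,2,3}" by (rule twist_in_R123)
  moreover have "evenperm (three_cycle a b c)"
    using d by (subst evenperm_comp[OF permutation_swap_id permutation_swap_id]) (simp add: evenperm_swap)
  ultimately have "three_cycle a b c \<in> R {1,2,3}" unfolding twist_def by (simp only: if_True)
  then show "three_cycle a b c \<in> R {..<5}" by (rule R_mono[rotated]) auto
qed

text \<open>Starting from \<open>q+5\<close>, each new vertex is joined by an edge of label 2, 3 or
  4 to one already reached, while two other reached vertices fixed by that generator serve as
  anchors.\<close>

lemma full_Y: "full Y"
proof -
  note [simp del] = add_2_eq_Suc'
  have low: "gen q 2 (q+2) = q+2" "gen q 3 (q+2) = q+2" "gen q 4 (q+2) = q+2" by simp_all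
  have 1: "full {q+6, q+2, q+3, q+4, q+5}"
    using full_insert[OF full_path_end, of 4 "q+2" "q+3" "q+5"] low by simp
  have 2: "full {q+7, q+6, q+2, q+3, q+4, q+5}"
    using full_insert[OF 1, of 3 "q+2" "q+3" "q+6"] low by simp
  have 3: "full {q+8, q+7, q+6, q+2, q+3, q+4, q+5}"
    using full_insert[OF 2, of 4 "q+2" "q+3" "q+7"] low by simp
  \<comment> \<open>\<open>\<rho>\<^sub>2\<close> moves \<open>q+3\<close>, so \<open>q+5\<close>
    takes its place as an anchor.\<close>
  have 4: "full {q+12, q+8, q+7, q+6, q+2, q+3, q+4, q+5}"
    using full_insert[OF 3, of 2 "q+2" "q+5" "q+7"] low by simp
  have 5: "full {q+13, q+12, q+8, q+7, q+6, q+2, q+3, q+4, q+5}"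
    using full_insert[OF 4, of 4 "q+2" "q+3" "q+12"] low by simp
  have 6: "full {q+11, q+13, q+12, q+8, q+7, q+6, q+2, q+3, q+4, q+5}"
    using full_insert[OF 5, of 3 "q+2" "q+3" "q+12"] low by simp
  have 7: "full {q+10, q+11, q+13, q+12, q+8, q+7, q+6, q+2, q+3, q+4, q+5}"
    using full_insert[OF 6, of 4 "q+2" "q+3" "q+11"] low by simp
  have 8: "full {q+9, q+10, q+11, q+13, q+12, q+8, q+7, q+6, q+2, q+3, q+4, q+5}"
    using full_insert[OF 7, of 3 "q+2" "q+3" "q+10"] low by simp
  have "{q+9, q+10, q+11, q+13, q+12, q+8, q+7, q+6, q+2, q+3, q+4, q+5} = Y"
    unfolding tail_points by blast
  with 8 show ?thesis by (simp only:)
qed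

text \<open>\<open>q+4\<close> and \<open>q+5\<close> are fixed by \<open>\<rho>\<^sub>0\<close> and
  \<open>\<rho>\<^sub>1\<close>, so they anchor the whole descent along the path.\<close>

lemma full_vertices: "full {1..n}"
proof -
  have "full {j..n}" if "1 \<le> j" "j \<le> q + 2" for j
    using that(2,1)
  proof (induction rule: inc_induct)
    case base
    show ?case using full_Y by simp
  next
    case (step m)
    \<comment> \<open>This is the label of the path edge joining \<open>m\<close> and
      \<open>m + 1\<close>.\<close>
    define k :: nat where "k = (if odd m then 0 else 1)"
    have k: "k < 5" "gen q k (m + 1) = m" "gen q k (q+4) = q+4" "gen q k (q+5) = q+5"
      using step.prems step.hyps unfolding k_def gen_0_apply gen_1_apply
      by (auto simp: gen_0_apply gen_1_apply simp del: One_nat_def)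
    have "full {Suc m..n}" using step by simp
    from full_insert[OF this k(1) _ _ k(3,4), of "m + 1"]
    have "full (insert m {Suc m..n})" using step.hyps k(2) by simp
    moreover have "insert m {Suc m..n} = {m..n}" using step.hyps by auto
    ultimately show ?case by (simp only:)
  qed
  from this[of 1] show ?thesis by simp
qed

lemma R_eq_alt_group: "R {..<5} = carrier (alt_group n)"
proof
  have "gen q ` {..<5} \<subseteq> carrier (alt_group n)"
    using gen_permutes evenperm_gen by (auto simp: alt_group_carrier)
  then show "R {..<5} \<subseteq> carrier (alt_group n)"
    by (rule generate_subgroup_incl[OF _ alt_group_is_subgroup])
  have "three_cycles n \<subseteq> R {..<5}"
  proof
    fix p assume "p \<in> three_cycles n"
    then obtain cs where cs: "p = cycle_of_list cs" "distinct cs" "length cs = 3" "set cs \<subseteq> {1..n}"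
      by blast
    then obtain a b c where abc: "cs = [a, b, c]"
      by (auto simp: length_Suc_conv eval_nat_numeral)
    have "p = three_cycle a b c" unfolding cs(1) abc cycle_of_list.simps by (simp only: comp_id)
    then show "p \<in> R {..<5}"
      using full_vertices cs(2,4) abc unfolding contains_three_cycles_def by auto
  qed
  moreover have "carrier (alt_group n) = generate (sym_group n) (three_cycles n)"
    using generate_consistent[OF three_cycles_incl alt_group_is_subgroup]
      alt_group_carrier_as_three_cycles[of n] by (simp add: alt_group_def)
  moreover have "subgroup (R {..<5}) (sym_group n)"
    by (rule generate_is_subgroup[OF gens_closed]) simp
  ultimately show "carrier (alt_group n) \<subseteq> R {..<5}"
    using generate_subgroup_incl by simp
qed

end

section \<open>Orders of the products of consecutive generators\<close>

lemma alt_group_pow: "x [^]\<^bsub>alt_group n\<^esub> (k :: nat) = x ^^ k"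
proof (induction k)
  case 0
  show ?case by (simp add: nat_pow_def alt_group_one)
next
  case (Suc k)
  have "x [^]\<^bsub>alt_group n\<^esub> Suc k = x ^^ k \<circ> x"
    using Suc by (simp add: nat_pow_def alt_group_mult)
  then show ?case by (simp only: funpow_Suc_right)
qed

lemma funpow_numeral_apply:
  "(f ^^ 2) x = f (f x)" "(f ^^ 3) x = f (f (f x))" "(f ^^ 5) x = f (f (f (f (f x))))"
  by (simp_all add: eval_nat_numeral)

text \<open>The relation says that the cube of \<open>a \<circ> b\<close> equals the cube of its
  inverse \<open>b \<circ> a\<close>.\<close>

lemma funpow_6_of_braid:
  fixes a b :: "'a \<Rightarrow> 'a"
  assumes "a \<circ> a = id" "b \<circ> b = id"
    and "a \<circ> b \<circ> a \<circ> b \<circ> a \<circ> b = b \<circ> a \<circ> b \<circ> a \<circ> b \<circ> a"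
  shows "(a \<circ> b) ^^ 6 = id"
proof
  fix x
  have a: "a (a x) = x" and b: "b (b x) = x" for x
    using assms(1,2) by (simp_all add: fun_eq_iff)
  have "a (b (a (b (a (b x))))) = b (a (b (a (b (a x)))))" for x
    using fun_cong[OF assms(3), of x] by simp
  from this[of "a (b (a (b (a (b x)))))"] show "((a \<circ> b) ^^ 6) x = id x"
    by (simp add: eval_nat_numeral a b)
qed

lemma (in group) ord_eq_6:
  assumes "x \<in> carrier G" "x [^] (6::nat) = \<one>" "x [^] (2::nat) \<noteq> \<one>" "x [^] (3::nat) \<noteq> \<one>"
  shows "ord x = 6"
proof -
  have d: "ord x dvd 6" "\<not> ord x dvd 2" "\<not> ord x dvd 3"
    using assms pow_eq_id by auto
  then have "ord x \<le> 6" by (intro dvd_imp_le) auto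
  then have "ord x \<in> {0,1,2,3,4,5,6}" by auto
  then show ?thesis using d by auto
qed

lemma (in group) ord_eq_5:
  assumes "x \<in> carrier G" "x [^] (5::nat) = \<one>" "x \<noteq> \<one>"
  shows "ord x = 5"
proof -
  have d: "ord x dvd 5" "ord x \<noteq> 1"
    using assms pow_eq_id ord_eq_1 by auto
  then have "ord x \<le> 5" by (intro dvd_imp_le) auto
  then have "ord x \<in> {0,1,2,3,4,5}" by auto
  then show ?thesis using d by auto
qed

context pentagon_graph
begin

text \<open>The index of a vertex along the cycle \<open>1, 2, 4, \<dots>, q+2, q+3, q+1, \<dots>, 3\<close> of \<open>\<rho>\<^sub>0\<rho>\<^sub>1\<close>.\<close>

definition pos :: "nat \<Rightarrow> nat" where
  "pos i = (if even i then i div 2 else if i = 1 then 0 else q + 3 - (i - 1) div 2)"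

lemma pos_less: "1 \<le> i \<Longrightarrow> i \<le> q + 3 \<Longrightarrow> pos i < q + 3"
  unfolding pos_def by (auto elim!: oddE)

text \<open>The rotation climbs through the even vertices, crosses from \<open>q+2\<close> to
  \<open>q+3\<close>, descends through the odd ones to \<open>1\<close>, and returns to
  \<open>2\<close>.\<close>

lemma pos_rotation:
  assumes "1 \<le> i" "i \<le> q + 3"
  shows "1 \<le> gen q 0 (gen q 1 i) \<and> gen q 0 (gen q 1 i) \<le> q + 3 \<and>
    pos (gen q 0 (gen q 1 i)) = (pos i + 1) mod (q + 3)"
proof -
  obtain h where h: "q = 2 * h" using even_q by blast
  consider (even) j where "i = 2 * j" "1 \<le> j" "j \<le> h" | (last) "i = 2 * h + 2" | (first) "i = 1"
    | (odd) j where "i = 2 * j + 1" "1 \<le> j" "j \<le> h + 1"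
  proof (cases "even i")
    case True
    then obtain j where "i = 2 * j" by blast
    moreover from this have "j \<le> h \<or> j = h + 1" "1 \<le> j" using assms h by linarith+
    ultimately show ?thesis using that(1)[of j] that(2) by auto
  next
    case False
    then obtain j where "i = 2 * j + 1" by (elim oddE)
    then show ?thesis using that(3) that(4)[of j] assms h by (cases "j = 0") auto
  qed
  then show ?thesis
  proof cases
    case even
    then have "gen q 0 (gen q 1 i) = 2 * (j + 1)"
      using h by (simp_all add: gen_0_apply[unfolded h] gen_1_apply[unfolded h] del: One_nat_def)
    moreover have "pos (2 * (j + 1)) = j + 1" "pos i = j"
      unfolding pos_def even by simp_all
    ultimately show ?thesis using even h by simp
  next
    case last
    then have "gen q 0 (gen q 1 i) = 2 * (h + 1) + 1"
      using h by (simp add: gen_0_apply[unfolded h] gen_1_apply[unfolded h] del: One_nat_def)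
    moreover have "pos (2 * (h + 1) + 1) = h + 2" "pos i = h + 1"
      unfolding pos_def unfolding last h by simp_all
    ultimately show ?thesis using h by simp
  next
    case first
    then have "gen q 0 (gen q 1 i) = 2"
      by (simp add: gen_0_apply gen_1_apply del: One_nat_def)
    then show ?thesis using first by (simp add: pos_def)
  next
    case odd
    then obtain l where l: "j = Suc l" using not0_implies_Suc by fastforce
    have e: "gen q 0 (gen q 1 i) = 2 * l + 1"
      using odd h by (simp add: l gen_0_apply[unfolded h] gen_1_apply[unfolded h] del: One_nat_def)
    have "pos i = q + 3 - Suc l" unfolding pos_def odd l by simp
    \<comment> \<open>The case \<open>l = 0\<close> is the wrap-around: vertex \<open>1\<close> has
      position \<open>0\<close> instead of \<open>q + 3\<close>.\<close>
    moreover have "pos (2 * l + 1) = (if l = 0 then 0 else q + 3 - l)" unfolding pos_def by simp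
    moreover have "l \<le> h" using odd l by simp
    ultimately show ?thesis unfolding e using h by (auto simp: Suc_diff_Suc mod_if)
  qed
qed

text \<open>Positions up to \<open>q div 2 + 1\<close> belong to \<open>1\<close> and the even
  vertices, larger ones to the remaining odd vertices, and \<open>pos\<close> is injective on each
  of the two classes.\<close>

lemma pos_inj:
  assumes "1 \<le> i" "i \<le> q + 3" "1 \<le> j" "j \<le> q + 3" "pos i = pos j"
  shows "i = j"
proof -
  have le: "pos k \<le> q div 2 + 1 \<longleftrightarrow> even k \<or> k = 1" if "1 \<le> k" "k \<le> q + 3" for k
    using that even_q unfolding pos_def by (auto elim!: evenE oddE)
  have "(even i \<or> i = 1) = (even j \<or> j = 1)" using assms le by metis
  then show ?thesis using assms even_q unfolding pos_def by (auto elim!: evenE oddE split: if_splits)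
qed

lemma rotation_pow:
  assumes "1 \<le> i" "i \<le> q + 3"
  shows "1 \<le> ((gen q 0 \<circ> gen q 1) ^^ k) i \<and> ((gen q 0 \<circ> gen q 1) ^^ k) i \<le> q + 3 \<and>
    pos (((gen q 0 \<circ> gen q 1) ^^ k) i) = (pos i + k) mod (q + 3)"
proof (induction k)
  case 0
  show ?case using assms pos_less[OF assms] by simp
next
  case (Suc k)
  let ?j = "((gen q 0 \<circ> gen q 1) ^^ k) i"
  have e: "((gen q 0 \<circ> gen q 1) ^^ Suc k) i = gen q 0 (gen q 1 ?j)"
    by simp
  have "(pos ?j + 1) mod (q + 3) = (pos i + Suc k) mod (q + 3)"
    using Suc by (simp only: mod_add_left_eq add.assoc Suc_eq_plus1)
  then show ?case unfolding e using pos_rotation[of ?j] Suc by (simp only: simp_thms)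
qed

text \<open>Vertex \<open>1\<close>, at position \<open>0\<close>, gives the divisibility.
  Conversely a multiple of \<open>q + 3\<close> restores all positions, and vertices off the path
  are fixed by both generators.\<close>

lemma rotation_pow_eq_id_iff: "(gen q 0 \<circ> gen q 1) ^^ k = id \<longleftrightarrow> (q + 3) dvd k"
proof
  assume "(gen q 0 \<circ> gen q 1) ^^ k = id"
  then have "pos 1 = (pos 1 + k) mod (q + 3)"
    using rotation_pow[of 1 k] by simp
  then show "(q + 3) dvd k" by (simp add: pos_def mod_eq_0_iff_dvd)
next
  assume k: "(q + 3) dvd k"
  show "(gen q 0 \<circ> gen q 1) ^^ k = id"
  proof
    fix i
    show "((gen q 0 \<circ> gen q 1) ^^ k) i = id i"
    proof (cases "1 \<le> i \<and> i \<le> q + 3")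
      case True
      then have i: "1 \<le> i" "i \<le> q + 3" by auto
      obtain c where c: "k = (q + 3) * c" using k by blast
      have "(pos i + k) mod (q + 3) = pos i" unfolding c using pos_less[OF i] by simp
      then show ?thesis using pos_inj[OF _ _ i] rotation_pow[OF i, of k] by simp
    next
      case False
      then have "gen q 0 i = i" "gen q 1 i = i" unfolding gen_0_apply gen_1_apply by auto
      then have "((gen q 0 \<circ> gen q 1) ^^ k) i = i" by (induction k) simp_all
      then show ?thesis by simp
    qed
  qed
qed

lemma gen_not_id: "i < 5 \<Longrightarrow> gen q i \<noteq> id"
proof -
  assume "i < 5"
  have "gen q 0 1 \<noteq> 1" by (simp add: gen_0_apply)
  moreover have "gen q 1 (q+3) \<noteq> q+3" "gen q 2 (q+3) \<noteq> q+3" "gen q 3 (q+4) \<noteq> q+4" "gen q 4 (q+5) \<noteq> q+5"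
    by simp_all
  ultimately show ?thesis using below_5[OF \<open>i < 5\<close>] by (metis id_apply)
qed

interpretation alt: group "alt_group n" by (rule alt_group_is_group)

lemma gen_comp_alt: "i < 5 \<Longrightarrow> j < 5 \<Longrightarrow> gen q i \<circ> gen q j \<in> carrier (alt_group n)"
  unfolding R_eq_alt_group[symmetric] by (intro R_comp R_gen) auto

lemma ord_01: "alt.ord (gen q 0 \<circ> gen q 1) = q + 3"
  using alt.ord_unique[OF gen_comp_alt[of 0 1]] rotation_pow_eq_id_iff
  by (simp add: alt_group_pow alt_group_one)

text \<open>The product is a 3-cycle on \<open>q+2, q+3, q+4\<close> and exchanges
  \<open>q+10\<close> and \<open>q+11\<close>, which excludes a trivial square and a trivial
  cube.\<close>

lemma ord_12: "alt.ord (gen q 1 \<circ> gen q 2) = 6"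
proof (rule alt.ord_eq_6[OF gen_comp_alt]; (unfold alt_group_pow alt_group_one)?)
  show "(gen q 1 \<circ> gen q 2) ^^ 6 = id"
    by (rule funpow_6_of_braid[OF gen_involution gen_involution braid_12]) auto
  show "(gen q 1 \<circ> gen q 2) ^^ 2 \<noteq> id"
    by (rule notI, drule fun_cong[of _ _ "q+4"]) (simp add: funpow_numeral_apply)
  show "(gen q 1 \<circ> gen q 2) ^^ 3 \<noteq> id"
    by (rule notI, drule fun_cong[of _ _ "q+10"]) (simp add: funpow_numeral_apply)
qed auto

text \<open>The product is a 3-cycle on \<open>q+3, q+4, q+5\<close> and exchanges
  \<open>q+8\<close> and \<open>q+13\<close>.\<close>

lemma ord_23: "alt.ord (gen q 2 \<circ> gen q 3) = 6"
proof (rule alt.ord_eq_6[OF gen_comp_alt]; (unfold alt_group_pow alt_group_one)?)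
  show "(gen q 2 \<circ> gen q 3) ^^ 6 = id"
    by (rule funpow_6_of_braid[OF gen_involution gen_involution braid_23]) auto
  show "(gen q 2 \<circ> gen q 3) ^^ 2 \<noteq> id"
    by (rule notI, drule fun_cong[of _ _ "q+4"]) (simp add: funpow_numeral_apply)
  show "(gen q 2 \<circ> gen q 3) ^^ 3 \<noteq> id"
    by (rule notI, drule fun_cong[of _ _ "q+8"]) (simp add: funpow_numeral_apply)
qed auto

text \<open>The labels 3 and 4 alternate along the \<open>u\<close> vertices and along the
  \<open>w\<close> vertices, so the product is a pair of 5-cycles.\<close>

lemma ord_34: "alt.ord (gen q 3 \<circ> gen q 4) = 5"
proof (rule alt.ord_eq_5[OF gen_comp_alt]; (unfold alt_group_pow alt_group_one)?)
  show "(gen q 3 \<circ> gen q 4) ^^ 5 = id"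
  proof
    fix x
    show "((gen q 3 \<circ> gen q 4) ^^ 5) x = id x"
      unfolding funpow_numeral_apply using points_cases[of x] by (elim disjE; simp)
  qed
  show "gen q 3 \<circ> gen q 4 \<noteq> id"
    by (rule notI, drule fun_cong[of _ _ "q+4"]) simp
qed auto

end

text \<open>Lets \<open>gen\<close> replace the graph permutations, with which it agrees only at
  indices below 5.\<close>

lemma string_C_group_cong:
  assumes "\<And>i. i < r \<Longrightarrow> \<rho> i = \<rho>' i"
  shows "string_C_group G \<rho> r = string_C_group G \<rho>' r"
proof -
  have im: "\<rho> ` J = \<rho>' ` J" if "J \<subseteq> {..<r}" for J
    using assms that by (intro image_cong) auto
  have "\<rho> ` (J \<inter> K) = \<rho>' ` (J \<inter> K)" if "J \<subseteq> {..<r}" for J K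
    using im[of "J \<inter> K"] that by blast
  with im show ?thesis
    unfolding string_C_group_def sggi_def intersection_property_def using assms by simp
qed

theorem theorem4p12:
  fixes n :: nat
  assumes "n \<ge> 15" and "n mod 4 = 3"
  shows "group412 n \<cong> alt_group n
         \<and> string_C_group (group412 n) (rho412 n) 5
         \<and> schlafli_type (group412 n) (rho412 n) 5 [n - 10, 6, 6, 5]"
proof -
  define q where "q = n - 13"
  have n: "n = q + 13" using assms(1) by (simp add: q_def)
  interpret pentagon_graph q
    by unfold_locales (use assms n in presburger)
  note rho = rho412_eq_gen[folded n]
  have img: "rho412 n ` {..<5} = gen q ` {..<5}"
    using rho by (intro image_cong) auto
  \<comment> \<open>The two groups are equal as structures, so the isomorphism is the
    identity.\<close>
  have alt: "group412 n = alt_group n"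
    unfolding group412_def img alt_group_def using R_eq_alt_group
    by (simp add: n alt_group_def)
  have gen_alt: "gen q ` {..<5} \<subseteq> carrier (alt_group n)"
    unfolding n R_eq_alt_group[symmetric] using R_gen by auto
  \<comment> \<open>Generation inside the subgroup agrees with generation in the symmetric group,
    where the intersection property was proved.\<close>
  have generate: "generate (alt_group n) (gen q ` J) = R J" if "J \<subseteq> {..<5}" for J
  proof -
    have "gen q ` J \<subseteq> carrier (alt_group (q + 13))" using gen_alt that n by blast
    from generate_consistent[OF this alt_group_is_subgroup] show ?thesis
      by (simp add: n alt_group_def)
  qed
  have "sggi (alt_group n) (gen q) 5"
    unfolding sggi_def alt_group_mult alt_group_one
  proof (intro conjI allI impI)
    show "group (alt_group n)" by (rule alt_group_is_group)
    show "generate (alt_group n) (gen q ` {..<5}) = carrier (alt_group n)"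
      unfolding generate[OF order.refl] R_eq_alt_group by (simp only: n)
    fix i :: nat assume i: "i < 5"
    show "gen q i \<in> carrier (alt_group n)" using gen_alt i by auto
    show "gen q i \<circ> gen q i = id" by (rule gen_involution[OF i])
    show "gen q i \<noteq> id"
      by (rule gen_not_id[OF i])
    fix j :: nat assume j: "j < 5" and ij: "i + 2 \<le> j \<or> j + 2 \<le> i"
    have c: "gen q i \<circ> gen q j = gen q j \<circ> gen q i"
      using ij gen_commute[of i j] gen_commute[of j i] i j by (elim disjE) simp_all
    have "(gen q i \<circ> gen q j) \<circ> (gen q i \<circ> gen q j) = gen q i \<circ> (gen q j \<circ> gen q j) \<circ> gen q i"
      by (subst (2) c) (simp only: comp_assoc)
    also have "\<dots> = id"
      using gen_involution[OF i] gen_involution[OF j] by (simp only: comp_id)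
    finally show "(gen q i \<circ> gen q j) [^]\<^bsub>alt_group n\<^esub> (2::nat) = id"
      by (simp only: alt_group_pow numeral_2_eq_2 funpow.simps comp_id)
  qed
  moreover have "intersection_property (alt_group n) (gen q) 5"
    unfolding intersection_property_def
  proof (intro allI impI)
    fix J K :: "nat set" assume JK: "J \<subseteq> {..<5}" "K \<subseteq> {..<5}"
    then have "J \<inter> K \<subseteq> {..<5}" by blast
    then show "generate (alt_group n) (gen q ` J) \<inter> generate (alt_group n) (gen q ` K) =
        generate (alt_group n) (gen q ` (J \<inter> K))"
      using intersection_property_gen JK generate unfolding intersection_property_on_def by metis
  qed
  ultimately have "string_C_group (alt_group n) (gen q) 5"
    by (simp add: string_C_group_def)
  then have "string_C_group (group412 n) (rho412 n) 5"
    unfolding alt by (subst string_C_group_cong[where \<rho>' = "gen q"]) (simp_all only: rho)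
  moreover have "schlafli_type (group412 n) (rho412 n) 5 [n - 10, 6, 6, 5]"
  proof -
    have "group.ord (alt_group n) (gen q (i - 1) \<circ> gen q i) = [n - 10, 6, 6, 5] ! (i - 1)"
      if "1 \<le> i \<and> i \<le> 4" for i
    proof -
      have "i = 1 \<or> i = 2 \<or> i = 3 \<or> i = 4" using that by linarith
      then show ?thesis using ord_01 ord_12 ord_23 ord_34 unfolding n by (elim disjE) simp_all
    qed
    moreover have "rho412 n (i - 1) = gen q (i - 1)" "rho412 n i = gen q i" if "1 \<le> i \<and> i \<le> 4" for i
      using that by (auto intro: rho)
    ultimately show ?thesis
      unfolding schlafli_type_def alt alt_group_mult by simp
  qed
  ultimately show ?thesis using iso_refl unfolding alt by blast
qed

end
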